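(* Let $G$ be a countable discrete group. Then $G$ is weakly amenable if and only if the reduced group $C^*$-algebra $C_r^*(G)$ has a cb-frame.
   Context: $C_r^*(G)$ is the norm closure of $\mathrm{span}\{\lambda_s:s\in G\}$ in $B(\ell_2(G))$, where $\lambda$ is the left regular representation, with its canonical operator space structure. $\|\cdot\|_{cb}$ is the completely bounded norm. $G$ is weakly amenable if there is a net $(\varphi_i)$ of finitely supported functions on $G$ with $\varphi_i\to1$ pointwise such that the multipliers $m_{\varphi_i}:\lambda_s\mapsto\varphi_i(s)\lambda_s$ on $C_r^*(G)$ satisfy $\sup_i\|m_{\varphi_i}\|_{cb}<\infty$. It is known (and may be used) that $G$ is weakly amenable if and only if $C_r^*(G)$ has the completely bounded approximation property, i.e. (for separable $X=C_r^*(G)$) there is a sequence of finite-rank maps $\Phi_k:X\to X$ with $\sup_k\|\Phi_k\|_{cb}<\infty$ and $\Phi_k(x)\to x$ for all $x\in X$. A cb-frame for an operator space $X$ is a sequence $(x_n,f_n)_{n\in\mathbb{N}}\subset X\times X^*$ with $x=\sum_{n=1}^\infty f_n(x)x_n$ (norm convergent) for all $x\in X$ and $\sup_m\|S_m\|_{cb}<\infty$, where $S_m(x)=\sum_{n=1}^mf_n(x)x_n$. *)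

theory Defs
  imports "HOL-Analysis.Analysis" "HOL-Algebra.Group"
begin

section \<open>The Hilbert space of square-summable functions\<close>

typedef 'a ell2 = "{f :: 'a \<Rightarrow> complex. (\<lambda>t. (cmod (f t))\<^sup>2) summable_on UNIV}"
  morphisms ell2_fun Abs_ell2
  by (rule exI[of _ "\<lambda>_. 0"]) simp

setup_lifting type_definition_ell2

lemma ell2_summable_add:
  fixes f g :: "'a \<Rightarrow> complex"
  assumes "(\<lambda>t. (cmod (f t))\<^sup>2) summable_on UNIV" "(\<lambda>t. (cmod (g t))\<^sup>2) summable_on UNIV"
  shows "(\<lambda>t. (cmod (f t + g t))\<^sup>2) summable_on UNIV"
proof (rule summable_on_comparison_test)
  show "(\<lambda>t. 2 * (cmod (f t))\<^sup>2 + 2 * (cmod (g t))\<^sup>2) summable_on UNIV"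
    using assms by (intro summable_on_add summable_on_cmult_right)
  show "(cmod (f t + g t))\<^sup>2 \<le> 2 * (cmod (f t))\<^sup>2 + 2 * (cmod (g t))\<^sup>2" for t
  proof -
    have "(cmod (f t + g t))\<^sup>2 \<le> (cmod (f t) + cmod (g t))\<^sup>2"
      by (intro power_mono norm_triangle_ineq norm_ge_zero)
    also have "\<dots> \<le> 2 * (cmod (f t))\<^sup>2 + 2 * (cmod (g t))\<^sup>2"
      using sum_squares_bound[of "cmod (f t)" "cmod (g t)"] by (simp add: power2_sum)
    finally show ?thesis .
  qed
qed auto

lemma ell2_summable_scale:
  fixes f :: "'a \<Rightarrow> complex"
  assumes "(\<lambda>t. (cmod (f t))\<^sup>2) summable_on UNIV"
  shows "(\<lambda>t. (cmod (c * f t))\<^sup>2) summable_on UNIV"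
  using summable_on_cmult_right[OF assms, of "(cmod c)\<^sup>2"]
  by (simp add: norm_mult power_mult_distrib)

lift_definition scaleC_ell2 :: "complex \<Rightarrow> 'a ell2 \<Rightarrow> 'a ell2" is "\<lambda>c f t. c * f t"
  by (rule ell2_summable_scale)

instantiation ell2 :: (type) real_vector
begin

lift_definition zero_ell2 :: "'a ell2" is "\<lambda>_. 0" by simp
lift_definition plus_ell2 :: "'a ell2 \<Rightarrow> 'a ell2 \<Rightarrow> 'a ell2" is "\<lambda>f g t. f t + g t"
  by (rule ell2_summable_add)
lift_definition uminus_ell2 :: "'a ell2 \<Rightarrow> 'a ell2" is "\<lambda>f t. - f t" by simp
lift_definition minus_ell2 :: "'a ell2 \<Rightarrow> 'a ell2 \<Rightarrow> 'a ell2" is "\<lambda>f g t. f t - g t"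
  subgoal for f g using ell2_summable_add[of f "\<lambda>t. - g t"] by simp
  done
lift_definition scaleR_ell2 :: "real \<Rightarrow> 'a ell2 \<Rightarrow> 'a ell2" is "\<lambda>r f t. complex_of_real r * f t"
  by (rule ell2_summable_scale)

instance
  by standard (transfer; auto simp: algebra_simps)+

end

instantiation ell2 :: (type) real_normed_vector
begin

lift_definition norm_ell2 :: "'a ell2 \<Rightarrow> real" is "\<lambda>f. sqrt (\<Sum>\<^sub>\<infinity>t. (cmod (f t))\<^sup>2)" .

definition "sgn_ell2 (\<xi> :: 'a ell2) = \<xi> /\<^sub>R norm \<xi>"
definition "dist_ell2 (\<xi> :: 'a ell2) \<eta> = norm (\<xi> - \<eta>)"
definition "uniformity_ell2 = (INF e\<in>{0<..}. principal {(\<xi> :: 'a ell2, \<eta>). dist \<xi> \<eta> < e})"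
definition "open_ell2 (U :: 'a ell2 set) \<longleftrightarrow>
  (\<forall>\<xi>\<in>U. \<forall>\<^sub>F (\<xi>', \<eta>) in uniformity. \<xi>' = \<xi> \<longrightarrow> \<eta> \<in> U)"

instance
proof
  fix \<xi> \<eta> :: "'a ell2" and r :: real and U :: "'a ell2 set"
  show "dist \<xi> \<eta> = norm (\<xi> - \<eta>)" by (rule dist_ell2_def)
  show "sgn \<xi> = \<xi> /\<^sub>R norm \<xi>" by (rule sgn_ell2_def)
  show "uniformity = (INF e\<in>{0<..}. principal {(\<xi> :: 'a ell2, \<eta>). dist \<xi> \<eta> < e})"
    by (rule uniformity_ell2_def)
  show "open U \<longleftrightarrow> (\<forall>\<xi>\<in>U. \<forall>\<^sub>F (\<xi>', \<eta>) in uniformity. \<xi>' = \<xi> \<longrightarrow> \<eta> \<in> U)"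
    by (rule open_ell2_def)
  show "norm \<xi> = 0 \<longleftrightarrow> \<xi> = 0"
  proof (transfer, rule iffI)
    fix f :: "'a \<Rightarrow> complex"
    assume s: "(\<lambda>t. (cmod (f t))\<^sup>2) summable_on UNIV" and "sqrt (\<Sum>\<^sub>\<infinity>t. (cmod (f t))\<^sup>2) = 0"
    then have 0: "(\<Sum>\<^sub>\<infinity>t. (cmod (f t))\<^sup>2) \<le> 0" by simp
    have "(cmod (f t))\<^sup>2 = 0" for t
      by (rule nonneg_infsum_le_0D[OF 0 s]) auto
    then show "f = (\<lambda>_. 0)" by auto
  qed simp
  show "norm (r *\<^sub>R \<xi>) = \<bar>r\<bar> * norm \<xi>"
    by transfer (simp add: norm_mult power_mult_distrib infsum_cmult_right' real_sqrt_mult)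
  show "norm (\<xi> + \<eta>) \<le> norm \<xi> + norm \<eta>"
  proof transfer
    fix f g :: "'a \<Rightarrow> complex"
    assume f: "(\<lambda>t. (cmod (f t))\<^sup>2) summable_on UNIV" and g: "(\<lambda>t. (cmod (g t))\<^sup>2) summable_on UNIV"
    let ?N = "\<lambda>h :: 'a \<Rightarrow> complex. sqrt (\<Sum>\<^sub>\<infinity>t. (cmod (h t))\<^sup>2)"
    have le: "L2_set (\<lambda>t. cmod (h t)) F \<le> ?N h"
      if "(\<lambda>t. (cmod (h t))\<^sup>2) summable_on UNIV" "finite F" for h :: "'a \<Rightarrow> complex" and F
      unfolding L2_set_def using that
      by (intro real_sqrt_le_mono finite_sum_le_infsum) auto
    have nn: "0 \<le> ?N h" for h by (simp add: infsum_nonneg)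
    have "(\<Sum>\<^sub>\<infinity>t. (cmod (f t + g t))\<^sup>2) \<le> (?N f + ?N g)\<^sup>2"
    proof (rule infsum_le_finite_sums[OF ell2_summable_add[OF f g]])
      fix F :: "'a set" assume F: "finite F"
      have "L2_set (\<lambda>t. cmod (f t + g t)) F \<le> L2_set (\<lambda>t. cmod (f t) + cmod (g t)) F"
        by (intro L2_set_mono norm_triangle_ineq norm_ge_zero)
      also have "\<dots> \<le> L2_set (\<lambda>t. cmod (f t)) F + L2_set (\<lambda>t. cmod (g t)) F"
        by (rule L2_set_triangle_ineq)
      also have "\<dots> \<le> ?N f + ?N g"
        by (intro add_mono le f g F)
      finally have "(L2_set (\<lambda>t. cmod (f t + g t)) F)\<^sup>2 \<le> (?N f + ?N g)\<^sup>2"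
        by (intro power_mono L2_set_nonneg)
      then show "(\<Sum>t\<in>F. (cmod (f t + g t))\<^sup>2) \<le> (?N f + ?N g)\<^sup>2"
        by (simp add: L2_set_def sum_nonneg)
    qed
    then show "?N (\<lambda>t. f t + g t) \<le> ?N f + ?N g"
      using nn by (intro real_le_lsqrt) (auto intro: add_nonneg_nonneg)
  qed
qed

end

section \<open>Complex scalars on bounded operators\<close>

text \<open>
  The library type of bounded operators is real-linear. Complex multiples are taken pointwise, and
  every operator used below lies in the norm-closed complex span of complex-linear operators.
\<close>

type_synonym 'a ell2_op = "'a ell2 \<Rightarrow>\<^sub>L 'a ell2"

lemma norm_scaleC_ell2: "norm (scaleC_ell2 c \<xi>) = cmod c * norm \<xi>"
  by transfer (simp add: norm_mult power_mult_distrib infsum_cmult_right' real_sqrt_mult)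

lemma bounded_linear_scaleC_ell2: "bounded_linear (scaleC_ell2 c)"
proof (rule bounded_linear_intro)
  show "scaleC_ell2 c (\<xi> + \<eta>) = scaleC_ell2 c \<xi> + scaleC_ell2 c \<eta>" for \<xi> \<eta> :: "'a ell2"
    by transfer (simp add: algebra_simps)
  show "scaleC_ell2 c (r *\<^sub>R \<xi>) = r *\<^sub>R scaleC_ell2 c \<xi>" for r and \<xi> :: "'a ell2"
    by transfer (simp add: algebra_simps)
  show "norm (scaleC_ell2 c \<xi>) \<le> norm \<xi> * cmod c" for \<xi> :: "'a ell2"
    by (simp add: norm_scaleC_ell2)
qed

definition scaleC_op :: "complex \<Rightarrow> 'a ell2_op \<Rightarrow> 'a ell2_op" (infixr "*\<^sub>C" 75) where
  "c *\<^sub>C T = Blinfun (\<lambda>\<xi>. scaleC_ell2 c (blinfun_apply T \<xi>))"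

lemma scaleC_op_apply: "blinfun_apply (c *\<^sub>C T) \<xi> = scaleC_ell2 c (blinfun_apply T \<xi>)"
  unfolding scaleC_op_def
  by (intro bounded_linear_Blinfun_apply[THEN fun_cong]
        bounded_linear_compose[OF bounded_linear_scaleC_ell2] blinfun.bounded_linear_right)

interpretation complex_op: module "scaleC_op :: complex \<Rightarrow> 'a ell2_op \<Rightarrow> 'a ell2_op"
proof
  fix a b :: complex and S T :: "'a ell2_op"
  have 1: "scaleC_ell2 a (\<xi> + \<eta>) = scaleC_ell2 a \<xi> + scaleC_ell2 a \<eta>" for \<xi> \<eta> :: "'a ell2"
    by transfer (simp add: algebra_simps)
  have 2: "scaleC_ell2 (a + b) \<xi> = scaleC_ell2 a \<xi> + scaleC_ell2 b \<xi>" for \<xi> :: "'a ell2"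
    by transfer (simp add: algebra_simps)
  have 3: "scaleC_ell2 a (scaleC_ell2 b \<xi>) = scaleC_ell2 (a * b) \<xi>" for \<xi> :: "'a ell2"
    by transfer (simp add: algebra_simps)
  have 4: "scaleC_ell2 1 \<xi> = \<xi>" for \<xi> :: "'a ell2"
    by transfer simp
  show "a *\<^sub>C (S + T) = a *\<^sub>C S + a *\<^sub>C T"
    by (rule blinfun_eqI) (simp add: scaleC_op_apply blinfun.add_left 1)
  show "(a + b) *\<^sub>C T = a *\<^sub>C T + b *\<^sub>C T"
    by (rule blinfun_eqI) (simp add: scaleC_op_apply blinfun.add_left 2)
  show "a *\<^sub>C b *\<^sub>C T = (a * b) *\<^sub>C T"
    by (rule blinfun_eqI) (simp add: scaleC_op_apply 3)
  show "1 *\<^sub>C T = T"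
    by (rule blinfun_eqI) (simp add: scaleC_op_apply 4)
qed

section \<open>Concrete operator spaces and completely bounded norms\<close>

text \<open>
  The norm of the \<open>n \<times> n\<close> operator matrix \<open>a\<close> (entries with index below \<open>n\<close>) as an operator on the
  \<open>n\<close>-fold Hilbert sum. An operator space is a complex subspace \<open>X\<close> of \<open>'a ell2_op\<close> with these
  matrix norms.
\<close>

definition op_matrix_norm :: "nat \<Rightarrow> (nat \<Rightarrow> nat \<Rightarrow> 'a ell2_op) \<Rightarrow> real" where
  "op_matrix_norm n a =
     (SUP \<xi>\<in>{\<xi> :: nat \<Rightarrow> 'a ell2. (\<Sum>j<n. (norm (\<xi> j))\<^sup>2) \<le> 1}.
        sqrt (\<Sum>i<n. (norm (\<Sum>j<n. blinfun_apply (a i j) (\<xi> j)))\<^sup>2))"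

definition cb_norm :: "'a ell2_op set \<Rightarrow> ('a ell2_op \<Rightarrow> 'a ell2_op) \<Rightarrow> ennreal" where
  "cb_norm X u =
     (SUP n. SUP a\<in>{a. (\<forall>i<n. \<forall>j<n. a i j \<in> X) \<and> op_matrix_norm n a \<le> 1}.
        ennreal (op_matrix_norm n (\<lambda>i j. u (a i j))))"

definition op_dual :: "'a ell2_op set \<Rightarrow> ('a ell2_op \<Rightarrow> complex) set" where
  "op_dual X = {f. (\<forall>x\<in>X. \<forall>y\<in>X. f (x + y) = f x + f y) \<and> (\<forall>c. \<forall>x\<in>X. f (c *\<^sub>C x) = c * f x) \<and>
                   (\<exists>K. \<forall>x\<in>X. cmod (f x) \<le> K * norm x)}"

definition bounded_clinear_self_map :: "'a ell2_op set \<Rightarrow> ('a ell2_op \<Rightarrow> 'a ell2_op) \<Rightarrow> bool" where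
  "bounded_clinear_self_map X u \<longleftrightarrow>
     (\<forall>x\<in>X. u x \<in> X) \<and> (\<forall>x\<in>X. \<forall>y\<in>X. u (x + y) = u x + u y) \<and>
     (\<forall>c. \<forall>x\<in>X. u (c *\<^sub>C x) = c *\<^sub>C u x) \<and> (\<exists>K. \<forall>x\<in>X. norm (u x) \<le> K * norm x)"

definition cb_frame ::
  "'a ell2_op set \<Rightarrow> (nat \<Rightarrow> 'a ell2_op) \<Rightarrow> (nat \<Rightarrow> 'a ell2_op \<Rightarrow> complex) \<Rightarrow> bool" where
  "cb_frame X x f \<longleftrightarrow>
     (\<forall>n. x n \<in> X \<and> f n \<in> op_dual X) \<and>
     (\<forall>y\<in>X. (\<lambda>n. f n y *\<^sub>C x n) sums y) \<and>
     (SUP m. cb_norm X (\<lambda>y. \<Sum>n<m. f n y *\<^sub>C x n)) < \<infinity>"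

definition has_cb_frame :: "'a ell2_op set \<Rightarrow> bool" where
  "has_cb_frame X \<longleftrightarrow> (\<exists>x f. cb_frame X x f)"

section \<open>The reduced group C*-algebra and weak amenability\<close>

text \<open>
  \<open>\<ell>\<^sub>2(G)\<close> is the subspace of \<open>'a ell2\<close> of functions vanishing off the carrier, and an operator on
  \<open>\<ell>\<^sub>2(G)\<close> is extended by zero to the orthogonal complement; this does not change matrix norms.
\<close>

definition left_regular :: "('a, 'b) monoid_scheme \<Rightarrow> 'a \<Rightarrow> 'a ell2_op" where
  "left_regular G s = Blinfun (\<lambda>\<xi>. Abs_ell2 (\<lambda>t.
     if t \<in> carrier G then ell2_fun \<xi> (inv\<^bsub>G\<^esub> s \<otimes>\<^bsub>G\<^esub> t) else 0))"

lemma left_regular_apply: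
  assumes "group G" and s: "s \<in> carrier G"
  shows "ell2_fun (blinfun_apply (left_regular G s) \<xi>) =
           (\<lambda>t. if t \<in> carrier G then ell2_fun \<xi> (inv\<^bsub>G\<^esub> s \<otimes>\<^bsub>G\<^esub> t) else 0)"
proof -
  interpret group G by fact
  define L where "L = (\<lambda>(f :: 'a \<Rightarrow> complex) t. if t \<in> carrier G then f (inv\<^bsub>G\<^esub> s \<otimes>\<^bsub>G\<^esub> t) else 0)"
  have inj: "inj_on (\<lambda>t. inv\<^bsub>G\<^esub> s \<otimes>\<^bsub>G\<^esub> t) (carrier G)"
    using s by (intro inj_onI) simp
  let ?im = "(\<lambda>t. inv\<^bsub>G\<^esub> s \<otimes>\<^bsub>G\<^esub> t) ` carrier G"
  have summ: "(\<lambda>t. (cmod (L f t))\<^sup>2) summable_on UNIV"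
    and le: "(\<Sum>\<^sub>\<infinity>t. (cmod (L f t))\<^sup>2) \<le> (\<Sum>\<^sub>\<infinity>t. (cmod (f t))\<^sup>2)"
    if f: "(\<lambda>t. (cmod (f t))\<^sup>2) summable_on UNIV" for f
  proof -
    have f': "(\<lambda>t. (cmod (f t))\<^sup>2) summable_on ?im"
      using f by (rule summable_on_subset_banach) simp
    then have "(\<lambda>t. (cmod (f (inv\<^bsub>G\<^esub> s \<otimes>\<^bsub>G\<^esub> t)))\<^sup>2) summable_on carrier G"
      using summable_on_reindex[OF inj, of "\<lambda>t. (cmod (f t))\<^sup>2"] by (simp add: o_def)
    then show "(\<lambda>t. (cmod (L f t))\<^sup>2) summable_on UNIV"
      by (rule summable_on_cong_neutral[THEN iffD1, rotated -1]) (auto simp: L_def)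
    have "(\<Sum>\<^sub>\<infinity>t. (cmod (L f t))\<^sup>2) = (\<Sum>\<^sub>\<infinity>t\<in>carrier G. (cmod (f (inv\<^bsub>G\<^esub> s \<otimes>\<^bsub>G\<^esub> t)))\<^sup>2)"
      by (rule infsum_cong_neutral) (auto simp: L_def)
    also have "\<dots> = (\<Sum>\<^sub>\<infinity>t\<in>?im. (cmod (f t))\<^sup>2)"
      using infsum_reindex[OF inj, of "\<lambda>t. (cmod (f t))\<^sup>2"] by (simp add: o_def)
    also have "\<dots> \<le> (\<Sum>\<^sub>\<infinity>t. (cmod (f t))\<^sup>2)"
      by (rule infsum_mono_neutral[OF f' f]) auto
    finally show "(\<Sum>\<^sub>\<infinity>t. (cmod (L f t))\<^sup>2) \<le> (\<Sum>\<^sub>\<infinity>t. (cmod (f t))\<^sup>2)" .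
  qed
  have rep: "ell2_fun (Abs_ell2 (L (ell2_fun \<xi>))) = L (ell2_fun \<xi>)" for \<xi>
    using summ[of "ell2_fun \<xi>"] ell2_fun[of \<xi>] by (intro Abs_ell2_inverse) auto
  have "bounded_linear (\<lambda>\<xi>. Abs_ell2 (L (ell2_fun \<xi>)))"
  proof (rule bounded_linear_intro[where K = 1])
    fix \<xi> \<eta> :: "'a ell2" and r :: real
    show "Abs_ell2 (L (ell2_fun (\<xi> + \<eta>))) = Abs_ell2 (L (ell2_fun \<xi>)) + Abs_ell2 (L (ell2_fun \<eta>))"
      by (subst ell2_fun_inject[symmetric])
         (subst rep[of "\<xi> + \<eta>"], simp only: plus_ell2.rep_eq rep, auto simp: L_def)
    show "Abs_ell2 (L (ell2_fun (r *\<^sub>R \<xi>))) = r *\<^sub>R Abs_ell2 (L (ell2_fun \<xi>))"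
      by (subst ell2_fun_inject[symmetric])
         (subst rep[of "r *\<^sub>R \<xi>"], simp only: scaleR_ell2.rep_eq rep, auto simp: L_def)
    show "norm (Abs_ell2 (L (ell2_fun \<xi>))) \<le> norm \<xi> * 1"
      using le[of "ell2_fun \<xi>"] ell2_fun[of \<xi>] by (simp add: norm_ell2.rep_eq rep)
  qed
  then show ?thesis
    using rep[of \<xi>] by (simp add: left_regular_def bounded_linear_Blinfun_apply L_def)
qed

definition reduced_Cstar :: "('a, 'b) monoid_scheme \<Rightarrow> 'a ell2_op set" where
  "reduced_Cstar G = closure (complex_op.span (left_regular G ` carrier G))"

text \<open>These conditions determine \<open>m\<close> on \<open>reduced_Cstar G\<close>, hence its cb-norm.\<close>

definition is_multiplier ::
  "('a, 'b) monoid_scheme \<Rightarrow> ('a \<Rightarrow> complex) \<Rightarrow> ('a ell2_op \<Rightarrow> 'a ell2_op) \<Rightarrow> bool" where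
  "is_multiplier G \<phi> m \<longleftrightarrow>
     bounded_clinear_self_map (reduced_Cstar G) m \<and>
     (\<forall>s\<in>carrier G. m (left_regular G s) = \<phi> s *\<^sub>C left_regular G s)"

text \<open>
  The net of functions is rendered by its filter of tails: \<open>\<Phi>\<close> is the set of its members and \<open>F\<close> a
  proper filter on \<open>\<Phi>\<close>. Conversely such an \<open>F\<close> yields a net in \<open>\<Phi>\<close>, indexed by the pairs \<open>(A, \<phi>)\<close>
  with \<open>A\<close> a set of \<open>F\<close> and \<open>\<phi> \<in> A \<inter> \<Phi>\<close>, ordered by reverse inclusion of \<open>A\<close>.
\<close>

definition weakly_amenable :: "('a, 'b) monoid_scheme \<Rightarrow> bool" where
  "weakly_amenable G \<longleftrightarrow>
     (\<exists>(\<Phi> :: ('a \<Rightarrow> complex) set) F m.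
        F \<noteq> bot \<and> F \<le> principal \<Phi> \<and>
        (\<forall>\<phi>\<in>\<Phi>. finite {s \<in> carrier G. \<phi> s \<noteq> 0}) \<and>
        (\<forall>s\<in>carrier G. ((\<lambda>\<phi>. \<phi> s) \<longlongrightarrow> 1) F) \<and>
        (\<forall>\<phi>\<in>\<Phi>. is_multiplier G \<phi> (m \<phi>)) \<and>
        (SUP \<phi>\<in>\<Phi>. cb_norm (reduced_Cstar G) (m \<phi>)) < \<infinity>)"

end

theory Submission imports Defs begin

text \<open>
  For weak amenability to produce a frame, note that a finitely supported \<open>\<phi>\<close> gives the finite-rank
  multiplier \<open>y \<mapsto> \<Sum>\<^sub>s \<phi>(s) y(s) \<lambda>\<^sub>s\<close>, where \<open>y(s)\<close> is the Fourier coefficient of \<open>y\<close>. A frame whose vectors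
  are multiples of the \<open>\<lambda>\<^sub>s\<close> and whose functionals are Fourier coefficients thus amounts to a sequence
  of finitely supported functions that starts at 0, changes one value at a time, converges to 1
  pointwise and has bounded multiplier cb-norms. Countability of the group extracts a sequence
  \<open>\<phi>\<^sub>k \<rightarrow> 1\<close> from the net; passing from \<open>\<phi>\<^sub>k\<close> to its successor along the segment between them in many
  small rounds of one-point changes costs at most 1 in cb-norm.

  Conversely, perturb the frame vectors so that the partial sums \<open>S\<close> have range in the span of the
  \<open>\<lambda>\<^sub>s\<close>. Then \<open>\<phi>(s) = \<tau>(\<lambda>\<^sub>s\<^sup>* S(\<lambda>\<^sub>s))\<close> is finitely supported, and its multiplier has cb-norm at most that of
  \<open>S\<close> by Haagerup's averaging argument.
\<close>

section \<open>Square-summable functions\<close>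

text \<open>Partial sums of a frame grow by one rank-one term at a time, whereas consecutive
  multipliers may differ at many points, and changing these one by one could cost the whole sum of
  the differences. Convexity is the way out: on the segment between two multipliers of cb-norm at
  most \<open>C\<close> the cb-norm stays at most \<open>C\<close>, so only the current incomplete
  round has to be paid for, and its price is divided by the number of rounds. The same segments keep
  intermediate values close to 1 once both ends are.

  Conversely, finite rank alone does not make \<open>\<phi>\<close> finitely supported, because an
  element of the algebra may have infinitely many nonzero Fourier coefficients; hence the
  perturbation. Averaging is usually phrased with the homomorphism sending
  \<open>\<lambda>\<^sub>s\<close> to \<open>\<lambda>\<^sub>s \<otimes> \<lambda>\<^sub>s\<close>.
  Here it is done with finite matrices: an \<open>n\<close>-by-\<open>n\<close> matrix over the
  algebra, tested on vectors supported in a finite set \<open>F\<close>, is a scalar matrix indexed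
  by pairs \<open>(i, r)\<close>, and \<open>S\<close> is applied to a matrix of that larger size.
  This is where complete boundedness of \<open>S\<close>, rather than boundedness, enters.\<close>

lemma norm_ell2_infsum:
  shows ell2_fun_summable: "(\<lambda>t. (cmod (ell2_fun \<xi> t))\<^sup>2) summable_on UNIV"
    and norm_ell2_power2: "(norm \<xi>)\<^sup>2 = (\<Sum>\<^sub>\<infinity>t. (cmod (ell2_fun \<xi> t))\<^sup>2)"
proof -
  show "(\<lambda>t. (cmod (ell2_fun \<xi> t))\<^sup>2) summable_on UNIV"
    using ell2_fun[of \<xi>] by simp
  show "(norm \<xi>)\<^sup>2 = (\<Sum>\<^sub>\<infinity>t. (cmod (ell2_fun \<xi> t))\<^sup>2)"
    by (simp add: norm_ell2.rep_eq infsum_nonneg)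
qed

lemma has_sum_norm_ell2: "((\<lambda>t. (cmod (ell2_fun \<xi> t))\<^sup>2) has_sum (norm \<xi>)\<^sup>2) UNIV"
  using ell2_fun_summable[of \<xi>] norm_ell2_power2[of \<xi>] by simp

lemma L2_set_ell2_fun_le:
  assumes "finite F"
  shows "L2_set (\<lambda>t. cmod (ell2_fun \<xi> t)) F \<le> norm \<xi>"
proof -
  have "(\<Sum>t\<in>F. (cmod (ell2_fun \<xi> t))\<^sup>2) \<le> (norm \<xi>)\<^sup>2"
    unfolding norm_ell2_power2 using ell2_fun_summable assms
    by (intro finite_sum_le_infsum) auto
  then show ?thesis
    unfolding L2_set_def by (intro real_le_lsqrt) (auto simp: sum_nonneg)
qed

lemma cmod_ell2_fun_le: "cmod (ell2_fun \<xi> t) \<le> norm \<xi>"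
  using L2_set_ell2_fun_le[of "{t}" \<xi>] by (simp add: L2_set_def)

lemma bounded_linear_ell2_fun: "bounded_linear (\<lambda>\<xi>. ell2_fun \<xi> t)"
  by (rule bounded_linear_intro[where K = 1])
     (auto simp: plus_ell2.rep_eq scaleR_ell2.rep_eq scaleR_conv_of_real cmod_ell2_fun_le)

lemmas ell2_fun_sum = linear_sum[OF bounded_linear.linear[OF bounded_linear_ell2_fun]]

lemma ell2_eqI: "(\<And>t. ell2_fun \<xi> t = ell2_fun \<eta> t) \<Longrightarrow> \<xi> = \<eta>"
  using ell2_fun_inject by blast

lift_definition delta :: "'a \<Rightarrow> 'a ell2" is "\<lambda>s t. if t = s then 1 else 0"
proof -
  fix s :: 'a
  have "(\<lambda>t. (cmod (if t = s then 1 else 0))\<^sup>2) summable_on {s}"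
    by (rule summable_on_finite) simp
  then show "(\<lambda>t. (cmod (if t = s then 1 else 0))\<^sup>2) summable_on UNIV"
    by (rule summable_on_cong_neutral[THEN iffD1, rotated -1]) auto
qed

lemma norm_finite_ell2:
  assumes F: "finite F" and "\<And>t. t \<notin> F \<Longrightarrow> ell2_fun \<xi> t = 0"
  shows "norm \<xi> = L2_set (\<lambda>t. cmod (ell2_fun \<xi> t)) F"
proof -
  have "(\<Sum>\<^sub>\<infinity>t. (cmod (ell2_fun \<xi> t))\<^sup>2) = (\<Sum>\<^sub>\<infinity>t\<in>F. (cmod (ell2_fun \<xi> t))\<^sup>2)"
    using assms(2) by (intro infsum_cong_neutral) auto
  then show ?thesis
    by (simp add: norm_ell2.rep_eq L2_set_def F)
qed

lemma norm_delta: "norm (delta t) = 1"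
  by (subst norm_finite_ell2[of "{t}"]) (auto simp: delta.rep_eq L2_set_def)

definition truncate_ell2 :: "'a set \<Rightarrow> 'a ell2 \<Rightarrow> 'a ell2" where
  "truncate_ell2 F \<xi> = (\<Sum>t\<in>F. scaleC_ell2 (ell2_fun \<xi> t) (delta t))"

lemma ell2_fun_sum_delta:
  assumes "finite F"
  shows "ell2_fun (\<Sum>t\<in>F. scaleC_ell2 (c t) (delta t)) r = (if r \<in> F then c r else 0)"
  using assms by (simp add: ell2_fun_sum scaleC_ell2.rep_eq delta.rep_eq if_distrib cong: if_cong)

lemma norm_sum_delta:
  assumes "finite F"
  shows "norm (\<Sum>t\<in>F. scaleC_ell2 (c t) (delta t)) = L2_set (\<lambda>t. cmod (c t)) F"
  by (subst norm_finite_ell2[of F]) (auto simp: ell2_fun_sum_delta assms intro!: L2_set_cong)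

lemma ell2_fun_truncate:
  "finite F \<Longrightarrow> ell2_fun (truncate_ell2 F \<xi>) r = (if r \<in> F then ell2_fun \<xi> r else 0)"
  by (simp add: truncate_ell2_def ell2_fun_sum_delta)

text \<open>The squared error is the tail of the convergent series for the squared norm.\<close>

lemma truncate_ell2_tendsto: "((\<lambda>F. truncate_ell2 F \<xi>) \<longlongrightarrow> \<xi>) (finite_subsets_at_top UNIV)"
proof -
  let ?T = "finite_subsets_at_top (UNIV :: 'a set)"
  let ?s = "\<lambda>F. \<Sum>t\<in>F. (cmod (ell2_fun \<xi> t))\<^sup>2"
  have sq: "(norm (truncate_ell2 F \<xi> - \<xi>))\<^sup>2 = (norm \<xi>)\<^sup>2 - ?s F" if F: "finite F" for F
  proof -
    have "((\<lambda>t. (cmod (ell2_fun \<xi> t))\<^sup>2) has_sum ((norm \<xi>)\<^sup>2 - ?s F)) (UNIV - F)"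
      using F by (intro has_sum_Diff[OF has_sum_norm_ell2 has_sum_finite]) auto
    then have "((\<lambda>t. (cmod (ell2_fun (truncate_ell2 F \<xi> - \<xi>) t))\<^sup>2) has_sum ((norm \<xi>)\<^sup>2 - ?s F)) UNIV"
      by (rule has_sum_cong_neutral[THEN iffD1, rotated -1])
         (auto simp: minus_ell2.rep_eq ell2_fun_truncate F)
    then show ?thesis
      using has_sum_norm_ell2 has_sum_unique by blast
  qed
  have "(?s \<longlongrightarrow> (norm \<xi>)\<^sup>2) ?T"
    using has_sum_norm_ell2[of \<xi>] by (simp add: has_sum_def)
  then have "((\<lambda>F. sqrt ((norm \<xi>)\<^sup>2 - ?s F)) \<longlongrightarrow> sqrt ((norm \<xi>)\<^sup>2 - (norm \<xi>)\<^sup>2)) ?T"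
    by (intro tendsto_intros)
  moreover have "\<forall>\<^sub>F F in ?T. sqrt ((norm \<xi>)\<^sup>2 - ?s F) = norm (truncate_ell2 F \<xi> - \<xi>)"
    by (rule eventually_finite_subsets_at_top_weakI) (simp flip: sq)
  ultimately have "((\<lambda>F. norm (truncate_ell2 F \<xi> - \<xi>)) \<longlongrightarrow> 0) ?T"
    by (simp add: tendsto_cong)
  then show ?thesis
    using LIM_zero_cancel tendsto_norm_zero_iff by blast
qed

text \<open>The finite coordinate sums converge to the squared norms. Through this lemma, estimates
  in a Hilbert sum are reduced to finite scalar sums.\<close>

lemma L2_set_norm_le_of_finite:
  fixes A :: "'i \<Rightarrow> 'a ell2"
  assumes I: "finite I" and "\<And>F. finite F \<Longrightarrow> L2_set (\<lambda>(i, r). cmod (ell2_fun (A i) r)) (I \<times> F) \<le> K"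
  shows "L2_set (\<lambda>i. norm (A i)) I \<le> K"
proof -
  let ?T = "finite_subsets_at_top (UNIV :: 'a set)"
  have K: "0 \<le> K" using assms(2)[of "{}"] by simp
  have "((\<lambda>F. \<Sum>i\<in>I. \<Sum>r\<in>F. (cmod (ell2_fun (A i) r))\<^sup>2) \<longlongrightarrow> (\<Sum>i\<in>I. (norm (A i))\<^sup>2)) ?T"
    using has_sum_norm_ell2 by (intro tendsto_sum) (auto simp: has_sum_def)
  moreover have "\<forall>\<^sub>F F in ?T. (\<Sum>i\<in>I. \<Sum>r\<in>F. (cmod (ell2_fun (A i) r))\<^sup>2) \<le> K\<^sup>2"
  proof (rule eventually_finite_subsets_at_top_weakI)
    fix F :: "'a set" assume F: "finite F"
    have "(\<Sum>i\<in>I. \<Sum>r\<in>F. (cmod (ell2_fun (A i) r))\<^sup>2) = (L2_set (\<lambda>(i, r). cmod (ell2_fun (A i) r)) (I \<times> F))\<^sup>2"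
      by (simp add: L2_set_def sum.cartesian_product sum_nonneg case_prod_beta)
    also have "\<dots> \<le> K\<^sup>2" using assms(2)[OF F] by (intro power_mono) auto
    finally show "(\<Sum>i\<in>I. \<Sum>r\<in>F. (cmod (ell2_fun (A i) r))\<^sup>2) \<le> K\<^sup>2" .
  qed
  ultimately have "(\<Sum>i\<in>I. (norm (A i))\<^sup>2) \<le> K\<^sup>2"
    by (rule tendsto_upperbound) simp
  then show ?thesis
    unfolding L2_set_def using K by (intro real_le_lsqrt) (auto simp: sum_nonneg)
qed

text \<open>This is the norm of the scalar matrix \<open>c\<close> tensored with the identity. The
  matrix acts on each coordinate \<open>r\<close> separately, so the squared scalar estimates can be
  summed over \<open>r\<close>.\<close>

lemma scalar_matrix_amplification:
  fixes \<xi> :: "'j \<Rightarrow> 'a ell2"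
  assumes IJ: "finite I" "finite J" and K: "0 \<le> K"
    and c: "\<And>z. L2_set (\<lambda>i. cmod (\<Sum>j\<in>J. c i j * z j)) I \<le> K * L2_set (\<lambda>j. cmod (z j)) J"
  shows "L2_set (\<lambda>i. norm (\<Sum>j\<in>J. scaleC_ell2 (c i j) (\<xi> j))) I \<le> K * L2_set (\<lambda>j. norm (\<xi> j)) J"
proof (rule L2_set_norm_le_of_finite[OF IJ(1)])
  fix F :: "'a set" assume F: "finite F"
  have sq: "(\<Sum>i\<in>I. (cmod (\<Sum>j\<in>J. c i j * z j))\<^sup>2) \<le> K\<^sup>2 * (\<Sum>j\<in>J. (cmod (z j))\<^sup>2)" for z
    using power_mono[OF c[of z], of 2] L2_set_nonneg
    by (simp add: L2_set_def sum_nonneg power_mult_distrib)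
  have "(\<Sum>(i, r)\<in>I \<times> F. (cmod (ell2_fun (\<Sum>j\<in>J. scaleC_ell2 (c i j) (\<xi> j)) r))\<^sup>2)
      = (\<Sum>r\<in>F. \<Sum>i\<in>I. (cmod (\<Sum>j\<in>J. c i j * ell2_fun (\<xi> j) r))\<^sup>2)"
    by (subst sum.swap) (simp add: sum.cartesian_product ell2_fun_sum scaleC_ell2.rep_eq)
  also have "\<dots> \<le> (\<Sum>r\<in>F. K\<^sup>2 * (\<Sum>j\<in>J. (cmod (ell2_fun (\<xi> j) r))\<^sup>2))"
    by (intro sum_mono sq)
  also have "\<dots> = K\<^sup>2 * (\<Sum>j\<in>J. \<Sum>r\<in>F. (cmod (ell2_fun (\<xi> j) r))\<^sup>2)"
    by (subst sum.swap) (simp add: sum_distrib_left)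
  also have "\<dots> \<le> K\<^sup>2 * (\<Sum>j\<in>J. (norm (\<xi> j))\<^sup>2)"
  proof (intro mult_left_mono sum_mono)
    show "(\<Sum>r\<in>F. (cmod (ell2_fun (\<xi> j) r))\<^sup>2) \<le> (norm (\<xi> j))\<^sup>2" for j
      using power_mono[OF L2_set_ell2_fun_le[OF F, of "\<xi> j"], of 2]
      by (simp add: L2_set_def sum_nonneg)
  qed simp
  finally have "sqrt (\<Sum>(i, r)\<in>I \<times> F. (cmod (ell2_fun (\<Sum>j\<in>J. scaleC_ell2 (c i j) (\<xi> j)) r))\<^sup>2)
      \<le> sqrt (K\<^sup>2 * (\<Sum>j\<in>J. (norm (\<xi> j))\<^sup>2))"
    by (rule real_sqrt_le_mono)
  then show "L2_set (\<lambda>(i, r). cmod (ell2_fun (\<Sum>j\<in>J. scaleC_ell2 (c i j) (\<xi> j)) r)) (I \<times> F)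
      \<le> K * L2_set (\<lambda>j. norm (\<xi> j)) J"
    using K by (simp add: L2_set_def real_sqrt_mult case_prod_beta)
qed

lemma scaleC_ell2_simps:
  "scaleC_ell2 a (\<xi> + \<eta>) = scaleC_ell2 a \<xi> + scaleC_ell2 a \<eta>"
  "scaleC_ell2 (a + b) \<xi> = scaleC_ell2 a \<xi> + scaleC_ell2 b \<xi>"
  "scaleC_ell2 a (scaleC_ell2 b \<xi>) = scaleC_ell2 (a * b) \<xi>"
  "scaleC_ell2 1 \<xi> = \<xi>" "scaleC_ell2 0 \<xi> = 0" "scaleC_ell2 a 0 = 0"
  "scaleC_ell2 (complex_of_real r) \<xi> = r *\<^sub>R \<xi>"
  by (rule ell2_eqI; simp add: scaleC_ell2.rep_eq plus_ell2.rep_eq zero_ell2.rep_eq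
        scaleR_ell2.rep_eq algebra_simps)+

lemmas scaleC_ell2_sum = linear_sum[OF bounded_linear.linear[OF bounded_linear_scaleC_ell2]]

section \<open>Matrix bounds and complete boundedness\<close>

text \<open>The index set is arbitrary because averaging works with matrices indexed by pairs; a
  homogeneous inequality is easier to compose than a supremum over the unit ball.\<close>

definition op_matrix_bound :: "'i set \<Rightarrow> ('i \<Rightarrow> 'i \<Rightarrow> 'a ell2_op) \<Rightarrow> real \<Rightarrow> bool" where
  "op_matrix_bound I a K \<longleftrightarrow>
     (\<forall>\<xi>. L2_set (\<lambda>i. norm (\<Sum>j\<in>I. blinfun_apply (a i j) (\<xi> j))) I
          \<le> K * L2_set (\<lambda>j. norm (\<xi> j)) I)"

lemma op_matrix_boundD:
  "op_matrix_bound I a K \<Longrightarrow>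
    L2_set (\<lambda>i. norm (\<Sum>j\<in>I. blinfun_apply (a i j) (\<xi> j))) I \<le> K * L2_set (\<lambda>j. norm (\<xi> j)) I"
  by (simp add: op_matrix_bound_def)

text \<open>A real supremum is informative only for a bounded set, so the crude bound by the sum of
  all entry norms comes first. Homogeneity then passes from the unit ball to all vectors.\<close>

lemma op_matrix_norm_le_iff:
  assumes K: "0 \<le> K"
  shows "op_matrix_norm n a \<le> K \<longleftrightarrow> op_matrix_bound {..<n} a K"
proof -
  define B where "B = {\<xi> :: nat \<Rightarrow> 'a ell2. (\<Sum>j<n. (norm (\<xi> j))\<^sup>2) \<le> 1}"
  define h where "h \<xi> = L2_set (\<lambda>i. norm (\<Sum>j<n. blinfun_apply (a i j) (\<xi> j))) {..<n}" for \<xi>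
  define N where "N \<xi> = L2_set (\<lambda>j. norm (\<xi> j)) {..<n}" for \<xi> :: "nat \<Rightarrow> 'a ell2"
  have norm_eq: "op_matrix_norm n a = (SUP \<xi>\<in>B. h \<xi>)"
    unfolding op_matrix_norm_def B_def h_def L2_set_def ..
  have B: "\<xi> \<in> B \<longleftrightarrow> N \<xi> \<le> 1" for \<xi>
    by (simp add: B_def N_def L2_set_def)
  have "(\<lambda>_. 0) \<in> B" by (simp add: B_def)
  have bdd: "bdd_above (h ` B)"
  proof (rule bdd_aboveI2)
    fix \<xi> assume "\<xi> \<in> B"
    then have le: "norm (\<xi> j) \<le> 1" if "j < n" for j
      using member_le_L2_set[of "{..<n}" j "\<lambda>j. norm (\<xi> j)"] that by (simp add: B N_def)
    have "h \<xi> \<le> (\<Sum>i<n. norm (\<Sum>j<n. blinfun_apply (a i j) (\<xi> j)))"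
      unfolding h_def by (rule L2_set_le_sum) simp
    also have "\<dots> \<le> (\<Sum>i<n. \<Sum>j<n. norm (a i j))"
    proof (intro sum_mono order_trans[OF norm_sum])
      fix i j assume "j \<in> {..<n}"
      then show "norm (blinfun_apply (a i j) (\<xi> j)) \<le> norm (a i j)"
        using norm_blinfun[of "a i j" "\<xi> j"] mult_left_mono[OF le[of j] norm_ge_zero[of "a i j"]]
        by simp
    qed
    finally show "h \<xi> \<le> (\<Sum>i<n. \<Sum>j<n. norm (a i j))" .
  qed
  have "op_matrix_norm n a \<le> K \<longleftrightarrow> (\<forall>\<xi>\<in>B. h \<xi> \<le> K)"
    unfolding norm_eq using \<open>(\<lambda>_. 0) \<in> B\<close> bdd by (subst cSUP_le_iff) auto
  also have "\<dots> \<longleftrightarrow> (\<forall>\<xi>. h \<xi> \<le> K * N \<xi>)"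
  proof safe
    fix \<xi> assume *: "\<forall>\<xi>\<in>B. h \<xi> \<le> K"
    have scale: "h (\<lambda>j. r *\<^sub>R \<xi> j) = r * h \<xi>" "N (\<lambda>j. r *\<^sub>R \<xi> j) = r * N \<xi>" if "0 \<le> r" for r
      using that by (simp_all add: h_def N_def blinfun.scaleR_right L2_set_right_distrib
          flip: scaleR_sum_right)
    show "h \<xi> \<le> K * N \<xi>"
    proof (cases "N \<xi> = 0")
      case True
      then have "\<xi> j = 0" if "j < n" for j
        using that unfolding N_def by (subst (asm) L2_set_eq_0_iff) auto
      then show ?thesis using True by (simp add: h_def L2_set_def)
    next
      case False
      then have pos: "N \<xi> > 0"
        unfolding N_def using L2_set_nonneg[of "\<lambda>j. norm (\<xi> j)" "{..<n}"] by linarith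
      then have "h (\<lambda>j. (1 / N \<xi>) *\<^sub>R \<xi> j) \<le> K"
        using scale[of "1 / N \<xi>"] by (intro *[rule_format]) (simp add: B)
      then show ?thesis
        using scale[of "1 / N \<xi>"] pos by (simp add: field_simps)
    qed
  next
    fix \<xi> assume "\<forall>\<xi>. h \<xi> \<le> K * N \<xi>" "\<xi> \<in> B"
    then show "h \<xi> \<le> K"
      using K mult_left_mono[of "N \<xi>" 1 K] by (simp add: B) (meson order_trans)
  qed
  finally show ?thesis by (simp add: op_matrix_bound_def h_def N_def)
qed

definition cb_bound :: "'a ell2_op set \<Rightarrow> ('a ell2_op \<Rightarrow> 'a ell2_op) \<Rightarrow> real \<Rightarrow> bool" where
  "cb_bound X u C \<longleftrightarrow>
     (\<forall>(n::nat) a. (\<forall>i<n. \<forall>j<n. a i j \<in> X) \<longrightarrow> op_matrix_bound {..<n} a 1 \<longrightarrow>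
        op_matrix_bound {..<n} (\<lambda>i j. u (a i j)) C)"

lemma cb_norm_le_iff:
  assumes "0 \<le> C"
  shows "cb_norm X u \<le> ennreal C \<longleftrightarrow> cb_bound X u C"
  using assms by (auto simp: cb_norm_def cb_bound_def SUP_le_iff ennreal_le_iff op_matrix_norm_le_iff)

lemma cb_bound_mono: "cb_bound X u C \<Longrightarrow> C \<le> D \<Longrightarrow> cb_bound X u D"
  unfolding cb_bound_def op_matrix_bound_def
  by (meson L2_set_nonneg mult_right_mono order_trans)

lemma cb_bound_cong: "(\<And>x. x \<in> X \<Longrightarrow> u x = v x) \<Longrightarrow> cb_bound X u C = cb_bound X v C"
  unfolding cb_bound_def op_matrix_bound_def L2_set_def by simp

lemma cb_bound_add:
  assumes u: "cb_bound X u C" and v: "cb_bound X v D"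
  shows "cb_bound X (\<lambda>x. u x + v x) (C + D)"
  unfolding cb_bound_def op_matrix_bound_def
proof (intro allI impI)
  fix n :: nat and a :: "nat \<Rightarrow> nat \<Rightarrow> 'a ell2_op" and \<xi> :: "nat \<Rightarrow> 'a ell2"
  assume X: "\<forall>i<n. \<forall>j<n. a i j \<in> X"
    and a: "\<forall>\<xi>. L2_set (\<lambda>i. norm (\<Sum>j<n. blinfun_apply (a i j) (\<xi> j))) {..<n}
        \<le> 1 * L2_set (\<lambda>j. norm (\<xi> j)) {..<n}"
  let ?s = "\<lambda>w i. \<Sum>j<n. blinfun_apply (w (a i j)) (\<xi> j)"
  have le: "L2_set (\<lambda>i. norm (?s w i)) {..<n} \<le> E * L2_set (\<lambda>j. norm (\<xi> j)) {..<n}"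
    if "cb_bound X w E" for w E
    using that X a by (simp add: cb_bound_def op_matrix_bound_def)
  have "L2_set (\<lambda>i. norm (?s (\<lambda>x. u x + v x) i)) {..<n} \<le> L2_set (\<lambda>i. norm (?s u i) + norm (?s v i)) {..<n}"
    by (rule L2_set_mono) (auto simp: blinfun.add_left sum.distrib norm_triangle_ineq)
  also have "\<dots> \<le> L2_set (\<lambda>i. norm (?s u i)) {..<n} + L2_set (\<lambda>i. norm (?s v i)) {..<n}"
    by (rule L2_set_triangle_ineq)
  also have "\<dots> \<le> (C + D) * L2_set (\<lambda>j. norm (\<xi> j)) {..<n}"
    using le[OF u] le[OF v] by (simp add: distrib_right)
  finally show "L2_set (\<lambda>i. norm (?s (\<lambda>x. u x + v x) i)) {..<n} \<le> (C + D) * L2_set (\<lambda>j. norm (\<xi> j)) {..<n}" .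
qed

lemma cb_bound_scaleC:
  assumes u: "cb_bound X u C"
  shows "cb_bound X (\<lambda>x. c *\<^sub>C u x) (cmod c * C)"
  unfolding cb_bound_def op_matrix_bound_def
proof (intro allI impI)
  fix n :: nat and a :: "nat \<Rightarrow> nat \<Rightarrow> 'a ell2_op" and \<xi> :: "nat \<Rightarrow> 'a ell2"
  assume X: "\<forall>i<n. \<forall>j<n. a i j \<in> X"
    and a: "\<forall>\<xi>. L2_set (\<lambda>i. norm (\<Sum>j<n. blinfun_apply (a i j) (\<xi> j))) {..<n}
        \<le> 1 * L2_set (\<lambda>j. norm (\<xi> j)) {..<n}"
  have "L2_set (\<lambda>i. norm (\<Sum>j<n. blinfun_apply (u (a i j)) (\<xi> j))) {..<n}
      \<le> C * L2_set (\<lambda>j. norm (\<xi> j)) {..<n}"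
    using u X a by (simp add: cb_bound_def op_matrix_bound_def)
  then have "cmod c * L2_set (\<lambda>i. norm (\<Sum>j<n. blinfun_apply (u (a i j)) (\<xi> j))) {..<n}
      \<le> cmod c * (C * L2_set (\<lambda>j. norm (\<xi> j)) {..<n})"
    by (rule mult_left_mono) simp
  then show "L2_set (\<lambda>i. norm (\<Sum>j<n. blinfun_apply (c *\<^sub>C u (a i j)) (\<xi> j))) {..<n}
      \<le> cmod c * C * L2_set (\<lambda>j. norm (\<xi> j)) {..<n}"
    by (simp add: scaleC_op_apply norm_scaleC_ell2 L2_set_right_distrib mult.assoc flip: scaleC_ell2_sum)
qed

lemma cb_bound_zero: "cb_bound X (\<lambda>x. 0) 0"
  by (simp add: cb_bound_def op_matrix_bound_def L2_set_def)

lemma cb_bound_sum: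
  assumes "finite A" "\<And>s. s \<in> A \<Longrightarrow> cb_bound X (u s) (C s)"
  shows "cb_bound X (\<lambda>x. \<Sum>s\<in>A. u s x) (\<Sum>s\<in>A. C s)"
  using assms by (induction A rule: finite_induct) (auto intro: cb_bound_add cb_bound_zero)

lemma L2_set_reindex_bij_betw:
  "bij_betw h I J \<Longrightarrow> L2_set (\<lambda>i. f (h i)) I = L2_set f J"
  unfolding L2_set_def using sum.reindex_bij_betw[of h I J "\<lambda>j. (f j)\<^sup>2"] by simp

text \<open>An enumeration of \<open>I\<close> transports matrices to indices below
  \<open>card I\<close>. The averaging argument uses this for index pairs consisting of a matrix
  index and a group element.\<close>

lemma cb_bound_finite_index:
  assumes u: "cb_bound X u C" and I: "finite I"
    and X: "\<And>i j. i \<in> I \<Longrightarrow> j \<in> I \<Longrightarrow> a i j \<in> X" and a: "op_matrix_bound I a 1"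
  shows "op_matrix_bound I (\<lambda>i j. u (a i j)) C"
proof -
  define n where "n = card I"
  obtain h where h: "bij_betw h {..<n} I"
    using ex_bij_betw_nat_finite[OF I] by (auto simp: n_def atLeast0LessThan)
  have reindex: "L2_set (\<lambda>i. norm (\<Sum>j\<in>I. blinfun_apply (b i j) (\<eta> j))) I =
        L2_set (\<lambda>i. norm (\<Sum>j<n. blinfun_apply (b (h i) (h j)) (\<eta> (h j)))) {..<n}"
      "L2_set (\<lambda>j. norm (\<eta> j)) I = L2_set (\<lambda>j. norm (\<eta> (h j))) {..<n}"
    for b :: "'b \<Rightarrow> 'b \<Rightarrow> 'a ell2_op" and \<eta>
  proof -
    have "(\<Sum>j<n. blinfun_apply (b i (h j)) (\<eta> (h j))) = (\<Sum>j\<in>I. blinfun_apply (b i j) (\<eta> j))" for i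
      by (rule sum.reindex_bij_betw[OF h])
    then show "L2_set (\<lambda>i. norm (\<Sum>j\<in>I. blinfun_apply (b i j) (\<eta> j))) I =
        L2_set (\<lambda>i. norm (\<Sum>j<n. blinfun_apply (b (h i) (h j)) (\<eta> (h j)))) {..<n}"
      by (simp only:) (rule L2_set_reindex_bij_betw[OF h, symmetric])
    show "L2_set (\<lambda>j. norm (\<eta> j)) I = L2_set (\<lambda>j. norm (\<eta> (h j))) {..<n}"
      by (rule L2_set_reindex_bij_betw[OF h, symmetric])
  qed
  have "op_matrix_bound {..<n} (\<lambda>i j. a (h i) (h j)) 1"
    unfolding op_matrix_bound_def
  proof
    fix \<xi> :: "nat \<Rightarrow> 'a ell2"
    define \<eta> where "\<eta> = \<xi> \<circ> inv_into {..<n} h"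
    have \<xi>: "\<xi> j = \<eta> (h j)" if "j < n" for j
      using that bij_betw_inv_into_left[OF h, of j] by (simp add: \<eta>_def)
    have "L2_set (\<lambda>i. norm (\<Sum>j<n. blinfun_apply (a (h i) (h j)) (\<xi> j))) {..<n}
        = L2_set (\<lambda>i. norm (\<Sum>j<n. blinfun_apply (a (h i) (h j)) (\<eta> (h j)))) {..<n}"
      "L2_set (\<lambda>j. norm (\<xi> j)) {..<n} = L2_set (\<lambda>j. norm (\<eta> (h j))) {..<n}"
      by (auto simp: \<xi> intro!: L2_set_cong)
    then show "L2_set (\<lambda>i. norm (\<Sum>j<n. blinfun_apply (a (h i) (h j)) (\<xi> j))) {..<n}
        \<le> 1 * L2_set (\<lambda>j. norm (\<xi> j)) {..<n}"
      using a[unfolded op_matrix_bound_def, rule_format, of \<eta>]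
      by (simp only: reindex(1)[of a \<eta>] reindex(2)[of \<eta>])
  qed
  moreover have "\<forall>i<n. \<forall>j<n. a (h i) (h j) \<in> X"
    using X h by (auto simp: bij_betw_def)
  ultimately have *: "op_matrix_bound {..<n} (\<lambda>i j. u (a (h i) (h j))) C"
    using u[unfolded cb_bound_def, rule_format, of n "\<lambda>i j. a (h i) (h j)"] by simp
  show ?thesis
    unfolding op_matrix_bound_def
  proof
    fix \<xi> :: "'b \<Rightarrow> 'a ell2"
    show "L2_set (\<lambda>i. norm (\<Sum>j\<in>I. blinfun_apply (u (a i j)) (\<xi> j))) I \<le> C * L2_set (\<lambda>j. norm (\<xi> j)) I"
      using *[unfolded op_matrix_bound_def, rule_format, of "\<lambda>j. \<xi> (h j)"]
      by (simp only: reindex(1)[of "\<lambda>i j. u (a i j)" \<xi>] reindex(2)[of \<xi>])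
  qed
qed

section \<open>Complex scalars and closed complex subspaces\<close>

lemma norm_scaleC_op_le: "norm (c *\<^sub>C T) \<le> cmod c * norm T"
proof (rule norm_blinfun_bound)
  show "norm (blinfun_apply (c *\<^sub>C T) \<xi>) \<le> cmod c * norm T * norm \<xi>" for \<xi>
    using mult_left_mono[OF norm_blinfun[of T \<xi>] norm_ge_zero[of c]]
    by (simp add: scaleC_op_apply norm_scaleC_ell2 mult.assoc)
qed simp

lemma scaleC_op_of_real: "complex_of_real r *\<^sub>C T = r *\<^sub>R T"
  by (rule blinfun_eqI) (simp add: scaleC_op_apply blinfun.scaleR_left scaleC_ell2_simps)

lemma bounded_linear_scaleC_op: "bounded_linear (\<lambda>T. c *\<^sub>C T)"
proof (rule bounded_linear_intro)
  show "c *\<^sub>C (r *\<^sub>R T) = r *\<^sub>R (c *\<^sub>C T)" for r and T :: "'a ell2_op"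
    by (simp add: mult.commute flip: scaleC_op_of_real)
  show "norm (c *\<^sub>C T) \<le> norm T * cmod c" for T :: "'a ell2_op"
    using norm_scaleC_op_le[of c T] by (simp add: mult.commute)
qed (rule complex_op.scale_right_distrib)

lemma subspace_closure:
  assumes "complex_op.subspace S"
  shows "complex_op.subspace (closure S)"
proof (rule complex_op.subspaceI)
  show "0 \<in> closure S"
    using assms closure_subset complex_op.subspace_0 by blast
  show "x + y \<in> closure S" if xy: "x \<in> closure S" "y \<in> closure S" for x y
  proof -
    obtain u v where uv: "\<forall>n. u n \<in> S" "u \<longlonglongrightarrow> x" "\<forall>n. v n \<in> S" "v \<longlonglongrightarrow> y"
      using xy unfolding closure_sequential by blast
    then have "\<forall>n. u n + v n \<in> S" "(\<lambda>n. u n + v n) \<longlonglongrightarrow> x + y"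
      using assms by (auto intro: tendsto_add complex_op.subspace_add)
    then show ?thesis unfolding closure_sequential by (intro exI[of _ "\<lambda>n. u n + v n"]) simp
  qed
  show "c *\<^sub>C x \<in> closure S" if xy: "x \<in> closure S" for c x
  proof -
    obtain u where u: "\<forall>n. u n \<in> S" "u \<longlonglongrightarrow> x"
      using xy unfolding closure_sequential by blast
    then have "\<forall>n. c *\<^sub>C u n \<in> S" "(\<lambda>n. c *\<^sub>C u n) \<longlonglongrightarrow> c *\<^sub>C x"
      using assms by (auto intro: bounded_linear.tendsto[OF bounded_linear_scaleC_op] complex_op.subspace_scale)
    then show ?thesis unfolding closure_sequential by (intro exI[of _ "\<lambda>n. c *\<^sub>C u n"]) simp
  qed
qed

section \<open>Bounded functionals and rank-one maps\<close>

definition clinear_op :: "'a ell2_op \<Rightarrow> bool" where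
  "clinear_op T \<longleftrightarrow> (\<forall>c \<xi>. blinfun_apply T (scaleC_ell2 c \<xi>) = scaleC_ell2 c (blinfun_apply T \<xi>))"

lemma op_dual_sum:
  assumes X: "complex_op.subspace X" and f: "f \<in> op_dual X" and "\<And>i. i \<in> I \<Longrightarrow> x i \<in> X"
  shows "f (\<Sum>i\<in>I. c i *\<^sub>C x i) = (\<Sum>i\<in>I. c i * f (x i))"
  using assms(3)
proof (induction I rule: infinite_finite_induct)
  have "f (0 *\<^sub>C 0) = 0 * f 0"
    using f complex_op.subspace_0[OF X] unfolding op_dual_def by blast
  then have f0: "f 0 = 0" by simp
  {
    case (infinite A)
    then show ?case by (simp add: f0)
  next
    case empty
    then show ?case by (simp add: f0)
  next
    case (insert i I)
    have "(\<Sum>i\<in>I. c i *\<^sub>C x i) \<in> X"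
      using insert.prems X by (intro complex_op.subspace_sum complex_op.subspace_scale) auto
    moreover have "c i *\<^sub>C x i \<in> X" "x i \<in> X"
      using insert.prems X by (auto intro: complex_op.subspace_scale)
    moreover have "\<forall>x\<in>X. \<forall>y\<in>X. f (x + y) = f x + f y" "\<forall>c. \<forall>x\<in>X. f (c *\<^sub>C x) = c * f x"
      using f by (auto simp: op_dual_def)
    ultimately show ?case using insert by simp
  }
qed

text \<open>A bounded functional is completely bounded with the same norm: with \<open>b\<^sub>i = \<Sum>\<^sub>j f(a\<^sub>i\<^sub>j) v\<^sub>j\<close>,
  the number \<open>\<Sum>\<^sub>i |b\<^sub>i|\<^sup>2\<close> is the value of \<open>f\<close> at \<open>\<Sum>\<^sub>i\<^sub>,\<^sub>j cnj(b\<^sub>i) v\<^sub>j a\<^sub>i\<^sub>j\<close>.\<close>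
lemma functional_matrix_bound:
  assumes X: "complex_op.subspace X" and f: "f \<in> op_dual X"
    and K: "0 \<le> K" "\<And>x. x \<in> X \<Longrightarrow> cmod (f x) \<le> K * norm x"
    and lin: "\<And>x. x \<in> X \<Longrightarrow> clinear_op x"
    and aX: "\<And>i j. i \<in> I \<Longrightarrow> j \<in> I \<Longrightarrow> a i j \<in> X" and a: "op_matrix_bound I a 1"
  shows "L2_set (\<lambda>i. cmod (\<Sum>j\<in>I. f (a i j) * v j)) I \<le> K * L2_set (\<lambda>j. cmod (v j)) I"
proof -
  define b where "b i = (\<Sum>j\<in>I. f (a i j) * v j)" for i
  define B where "B = L2_set (\<lambda>i. cmod (b i)) I"
  define V where "V = L2_set (\<lambda>j. cmod (v j)) I"
  define y where "y = (\<Sum>i\<in>I. cnj (b i) *\<^sub>C (\<Sum>j\<in>I. v j *\<^sub>C a i j))"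
  have inX: "(\<Sum>j\<in>I. v j *\<^sub>C a i j) \<in> X" if "i \<in> I" for i
    using aX X that by (intro complex_op.subspace_sum complex_op.subspace_scale) auto
  have yX: "y \<in> X"
    unfolding y_def by (rule complex_op.subspace_sum[OF X]) (rule complex_op.subspace_scale[OF X inX])
  have nn: "0 \<le> B" "0 \<le> V" by (simp_all add: B_def V_def)
  \<comment> \<open>Complex linearity of the entries moves \<open>v j\<close> onto the vector; then
    Cauchy-Schwarz in \<open>i\<close> and the bound on \<open>a\<close> apply.\<close>
  have "norm y \<le> B * V"
  proof (rule norm_blinfun_bound)
    fix \<xi> :: "'a ell2"
    define w where "w i = (\<Sum>j\<in>I. blinfun_apply (a i j) (scaleC_ell2 (v j) \<xi>))" for i
    have "blinfun_apply (\<Sum>j\<in>I. v j *\<^sub>C a i j) \<xi> = w i" if "i \<in> I" for i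
      using lin aX that by (simp add: w_def blinfun.sum_left scaleC_op_apply clinear_op_def)
    then have "blinfun_apply y \<xi> = (\<Sum>i\<in>I. scaleC_ell2 (cnj (b i)) (w i))"
      by (simp add: y_def blinfun.sum_left[of _ I] scaleC_op_apply)
    then have "norm (blinfun_apply y \<xi>) \<le> (\<Sum>i\<in>I. cmod (b i) * norm (w i))"
      using norm_sum[of "\<lambda>i. scaleC_ell2 (cnj (b i)) (w i)" I] by (simp add: norm_scaleC_ell2)
    also have "\<dots> \<le> B * L2_set (\<lambda>i. norm (w i)) I"
      using L2_set_mult_ineq[of "\<lambda>i. cmod (b i)" "\<lambda>i. norm (w i)" I] by (simp add: B_def)
    also have "L2_set (\<lambda>i. norm (w i)) I \<le> 1 * L2_set (\<lambda>j. norm (scaleC_ell2 (v j) \<xi>)) I"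
      unfolding w_def using a by (rule op_matrix_boundD)
    also have "1 * L2_set (\<lambda>j. norm (scaleC_ell2 (v j) \<xi>)) I = V * norm \<xi>"
      by (simp add: V_def norm_scaleC_ell2 L2_set_left_distrib)
    finally show "norm (blinfun_apply y \<xi>) \<le> B * V * norm \<xi>"
      using nn by (simp add: mult_left_mono mult.assoc)
  qed (use nn in simp)
  have "f y = (\<Sum>i\<in>I. cnj (b i) * b i)"
    unfolding y_def using inX aX
    by (simp add: op_dual_sum[OF X f] b_def mult.commute[of "v _"] cong: sum.cong)
  also have "\<dots> = complex_of_real (\<Sum>i\<in>I. (cmod (b i))\<^sup>2)"
    by (simp add: complex_norm_square mult.commute del: of_real_power)
  also have "(\<Sum>i\<in>I. (cmod (b i))\<^sup>2) = B\<^sup>2"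
    by (simp add: B_def L2_set_def sum_nonneg)
  finally have "B\<^sup>2 = cmod (f y)" by (simp add: norm_power)
  also have "\<dots> \<le> K * (B * V)"
    using K(2)[OF yX] mult_left_mono[OF \<open>norm y \<le> B * V\<close> K(1)] by simp
  finally have "B * B \<le> B * (K * V)"
    by (simp add: power2_eq_square mult_ac)
  then have "B \<le> K * V"
    using nn K(1) by (cases "B = 0") (auto simp: mult_le_cancel_left)
  then show ?thesis by (simp add: B_def V_def b_def)
qed

text \<open>The amplified map first applies \<open>x0\<close> in every coordinate and then the
  scalar matrix of the values \<open>f (a i j)\<close>, whose norm is at most
  \<open>K\<close>.\<close>

lemma cb_bound_rank_one:
  assumes X: "complex_op.subspace X" and f: "f \<in> op_dual X"
    and K: "0 \<le> K" "\<And>x. x \<in> X \<Longrightarrow> cmod (f x) \<le> K * norm x"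
    and lin: "\<And>x. x \<in> X \<Longrightarrow> clinear_op x"
  shows "cb_bound X (\<lambda>x. f x *\<^sub>C x0) (K * norm x0)"
  unfolding cb_bound_def
proof (intro allI impI)
  fix n and a :: "nat \<Rightarrow> nat \<Rightarrow> 'a ell2_op"
  assume aX: "\<forall>i<n. \<forall>j<n. a i j \<in> X" and a: "op_matrix_bound {..<n} a 1"
  show "op_matrix_bound {..<n} (\<lambda>i j. f (a i j) *\<^sub>C x0) (K * norm x0)"
    unfolding op_matrix_bound_def
  proof
    fix \<xi> :: "nat \<Rightarrow> 'a ell2"
    have "L2_set (\<lambda>i. norm (\<Sum>j<n. scaleC_ell2 (f (a i j)) (blinfun_apply x0 (\<xi> j)))) {..<n}
        \<le> K * L2_set (\<lambda>j. norm (blinfun_apply x0 (\<xi> j))) {..<n}"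
      using aX a by (intro scalar_matrix_amplification functional_matrix_bound[OF X f K lin]) (auto simp: K)
    also have "\<dots> \<le> K * L2_set (\<lambda>j. norm x0 * norm (\<xi> j)) {..<n}"
      using K(1) by (intro mult_left_mono L2_set_mono norm_blinfun) auto
    also have "\<dots> = K * norm x0 * L2_set (\<lambda>j. norm (\<xi> j)) {..<n}"
      by (simp add: L2_set_right_distrib)
    finally show "L2_set (\<lambda>i. norm (\<Sum>j<n. blinfun_apply (f (a i j) *\<^sub>C x0) (\<xi> j))) {..<n}
        \<le> K * norm x0 * L2_set (\<lambda>j. norm (\<xi> j)) {..<n}"
      by (simp add: scaleC_op_apply)
  qed
qed

text \<open>The case of 1-by-1 matrices, after normalising \<open>x\<close>.\<close>

lemma cb_bound_norm_le:
  assumes u: "cb_bound X u C" and X: "complex_op.subspace X" and x: "x \<in> X"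
    and hom: "\<And>c x. x \<in> X \<Longrightarrow> u (c *\<^sub>C x) = c *\<^sub>C u x"
  shows "norm (u x) \<le> C * norm x"
proof (cases "x = 0")
  case True
  have "u (0 *\<^sub>C x) = 0 *\<^sub>C u x" using hom x by blast
  then show ?thesis using True by simp
next
  case False
  define r where "r = 1 / norm x"
  have r: "r > 0" using False by (simp add: r_def)
  have "r *\<^sub>R x \<in> X"
    using complex_op.subspace_scale[OF X x, of "complex_of_real r"] by (simp add: scaleC_op_of_real)
  moreover have "op_matrix_bound {..<1::nat} (\<lambda>i j. r *\<^sub>R x) 1"
    unfolding op_matrix_bound_def
  proof
    fix \<xi> :: "nat \<Rightarrow> 'a ell2"
    show "L2_set (\<lambda>i. norm (\<Sum>j<1. blinfun_apply (r *\<^sub>R x) (\<xi> j))) {..<1::nat}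
        \<le> 1 * L2_set (\<lambda>j. norm (\<xi> j)) {..<1::nat}"
      using norm_blinfun[of "r *\<^sub>R x" "\<xi> 0"] False by (simp add: L2_set_def r_def)
  qed
  ultimately have *: "op_matrix_bound {..<1::nat} (\<lambda>i j. u (r *\<^sub>R x)) C"
    using u[unfolded cb_bound_def, rule_format, of 1 "\<lambda>i j. r *\<^sub>R x"] by simp
  have le: "norm (blinfun_apply (u (r *\<^sub>R x)) \<xi>) \<le> C * norm \<xi>" for \<xi>
    using *[unfolded op_matrix_bound_def, rule_format, of "\<lambda>_. \<xi>"] by (simp add: L2_set_def)
  \<comment> \<open>\<open>delta undefined\<close> is a unit vector whatever the type, and testing
    on it forces the sign of \<open>C\<close>.\<close>
  have "0 \<le> C"
    using order_trans[OF norm_ge_zero le[of "delta undefined"]] by (simp add: norm_delta)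
  then have "norm (u (r *\<^sub>R x)) \<le> C" using le by (rule norm_blinfun_bound)
  moreover have "u (r *\<^sub>R x) = r *\<^sub>R u x"
    using hom[OF x, of "complex_of_real r"] by (simp add: scaleC_op_of_real)
  ultimately show ?thesis using False by (simp add: r_def field_simps)
qed

section \<open>Fourier coefficients and averaging\<close>

lemma L2_set_Times: "L2_set g (I \<times> F) = L2_set (\<lambda>i. L2_set (\<lambda>r. g (i, r)) F) I"
  by (simp add: L2_set_def sum.cartesian_product sum_nonneg case_prod_beta)

text \<open>For \<open>T\<close> in the reduced algebra and \<open>s\<close> in the group this is
  \<open>\<tau>(\<lambda>\<^sub>s\<^sup>* T)\<close>, where \<open>\<tau>\<close> is the canonical
  trace.\<close>

definition fourier :: "('a, 'b) monoid_scheme \<Rightarrow> 'a ell2_op \<Rightarrow> 'a \<Rightarrow> complex" where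
  "fourier G T s = ell2_fun (blinfun_apply T (delta \<one>\<^bsub>G\<^esub>)) s"

lemma fourier_add: "fourier G (S + T) s = fourier G S s + fourier G T s"
  by (simp add: fourier_def blinfun.add_left plus_ell2.rep_eq)

lemma fourier_scaleC: "fourier G (c *\<^sub>C T) s = c * fourier G T s"
  by (simp add: fourier_def scaleC_op_apply scaleC_ell2.rep_eq)

lemma fourier_zero: "fourier G 0 s = 0"
  by (simp add: fourier_def zero_ell2.rep_eq)

lemma fourier_diff: "fourier G (S - T) s = fourier G S s - fourier G T s"
  by (simp add: fourier_def blinfun.diff_left minus_ell2.rep_eq)

lemma fourier_sum: "fourier G (\<Sum>i\<in>I. T i) s = (\<Sum>i\<in>I. fourier G (T i) s)"
  by (simp add: fourier_def blinfun.sum_left ell2_fun_sum)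

lemma cmod_fourier_le: "cmod (fourier G T s) \<le> norm T"
  using cmod_ell2_fun_le[of "blinfun_apply T (delta \<one>\<^bsub>G\<^esub>)" s] norm_blinfun[of T "delta \<one>\<^bsub>G\<^esub>"]
  by (simp add: fourier_def norm_delta)

lemma fourier_op_dual: "(\<lambda>T. fourier G T s) \<in> op_dual X"
  unfolding op_dual_def using cmod_fourier_le[of G _ s]
  by (auto simp: fourier_add fourier_scaleC intro!: exI[of _ 1])

section \<open>The regular representation and matrix entries of the reduced algebra\<close>

context group
begin

lemma left_regular_delta:
  assumes "s \<in> carrier G" "t \<in> carrier G"
  shows "blinfun_apply (left_regular G s) (delta t) = delta (s \<otimes> t)"
proof (rule ell2_eqI)
  fix q
  have "inv s \<otimes> q = t \<longleftrightarrow> q = s \<otimes> t" if "q \<in> carrier G"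
    using assms that by (metis inv_closed inv_solve_left inv_inv)
  then show "ell2_fun (blinfun_apply (left_regular G s) (delta t)) q = ell2_fun (delta (s \<otimes> t)) q"
    using assms by (auto simp: left_regular_apply[OF is_group] delta.rep_eq)
qed

lemma left_regular_mult:
  assumes "s \<in> carrier G" "t \<in> carrier G"
  shows "blinfun_apply (left_regular G s) (blinfun_apply (left_regular G t) \<xi>)
      = blinfun_apply (left_regular G (s \<otimes> t)) \<xi>"
  using assms
  by (intro ell2_eqI) (auto simp: left_regular_apply[OF is_group] inv_mult_group m_assoc)

lemma norm_left_regular_apply_le:
  assumes s: "s \<in> carrier G"
  shows "norm (blinfun_apply (left_regular G s) \<xi>) \<le> norm \<xi>"
proof -
  \<comment> \<open>A one-point index set specialises the criterion by finite coordinate sets to a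
    single vector.\<close>
  have "L2_set (\<lambda>i::unit. norm (blinfun_apply (left_regular G s) \<xi>)) {()} \<le> norm \<xi>"
  proof (rule L2_set_norm_le_of_finite)
    fix F :: "'a set" assume F: "finite F"
    let ?h = "\<lambda>t. inv s \<otimes> t"
    have inj: "inj_on ?h (F \<inter> carrier G)"
      using s by (intro inj_onI) simp
    have "(\<Sum>r\<in>F. (cmod (ell2_fun (blinfun_apply (left_regular G s) \<xi>) r))\<^sup>2)
        = (\<Sum>r\<in>F \<inter> carrier G. (cmod (ell2_fun \<xi> (?h r)))\<^sup>2)"
      using F s by (intro sum.mono_neutral_cong_right) (auto simp: left_regular_apply[OF is_group])
    also have "\<dots> = (\<Sum>r\<in>?h ` (F \<inter> carrier G). (cmod (ell2_fun \<xi> r))\<^sup>2)"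
      using inj by (simp add: sum.reindex)
    finally have "L2_set (\<lambda>(i, r). cmod (ell2_fun (blinfun_apply (left_regular G s) \<xi>) r)) ({()} \<times> F)
        = L2_set (\<lambda>r. cmod (ell2_fun \<xi> r)) (?h ` (F \<inter> carrier G))"
      by (simp add: L2_set_Times case_prod_beta) (simp add: L2_set_def sum_nonneg)
    also have "\<dots> \<le> norm \<xi>"
      using F by (intro L2_set_ell2_fun_le) auto
    finally show "L2_set (\<lambda>(i, r). cmod (ell2_fun (blinfun_apply (left_regular G s) \<xi>) r)) ({()} \<times> F)
        \<le> norm \<xi>" .
  qed simp
  then show ?thesis by (simp add: L2_set_def)
qed

lemma norm_left_regular_le: "s \<in> carrier G \<Longrightarrow> norm (left_regular G s) \<le> 1"
  by (rule norm_blinfun_bound) (auto simp: norm_left_regular_apply_le)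

lemma subspace_reduced_Cstar: "complex_op.subspace (reduced_Cstar G)"
  unfolding reduced_Cstar_def by (intro subspace_closure complex_op.subspace_span)

lemma left_regular_in: "s \<in> carrier G \<Longrightarrow> left_regular G s \<in> reduced_Cstar G"
  unfolding reduced_Cstar_def
  by (intro subsetD[OF closure_subset] complex_op.span_base) simp

text \<open>Serves as the induction rule for the algebra: closed linear conditions have to be
  checked on generators only.\<close>

lemma reduced_Cstar_subset:
  assumes "closed Q" "complex_op.subspace Q" "\<And>s. s \<in> carrier G \<Longrightarrow> left_regular G s \<in> Q"
  shows "reduced_Cstar G \<subseteq> Q"
  unfolding reduced_Cstar_def using assms
  by (intro closure_minimal complex_op.span_minimal) auto

text \<open>All four conditions are closed and linear, so the generators decide. The last one
  reflects that the algebra commutes with right translations: its matrix entries depend on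
  \<open>r \<otimes> inv t\<close> only. The two vanishing statements come from extending operators
  by zero off the group.\<close>

lemma reduced_Cstar_matrix_coeffs:
  assumes "T \<in> reduced_Cstar G"
  shows reduced_Cstar_clinear: "clinear_op T"
    and reduced_Cstar_apply_outside: "r \<notin> carrier G \<Longrightarrow> ell2_fun (blinfun_apply T \<xi>) r = 0"
    and reduced_Cstar_delta_outside: "t \<notin> carrier G \<Longrightarrow> blinfun_apply T (delta t) = 0"
    and reduced_Cstar_delta: "r \<in> carrier G \<Longrightarrow> t \<in> carrier G \<Longrightarrow>
          ell2_fun (blinfun_apply T (delta t)) r = fourier G T (r \<otimes> inv t)"
proof -
  note cont = bounded_linear.continuous_on[OF bounded_linear_ell2_fun]
    bounded_linear.continuous_on[OF bounded_linear_scaleC_ell2]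
    bounded_linear.continuous_on[OF bounded_linear_blinfun_apply] continuous_on_id continuous_on_const
    blinfun.bounded_linear_left[THEN bounded_linear.continuous_on]
  have "reduced_Cstar G \<subseteq> {T. clinear_op T}"
  proof (rule reduced_Cstar_subset)
    show "closed {T :: 'a ell2_op. clinear_op T}"
      unfolding clinear_op_def by (intro closed_Collect_all closed_Collect_eq cont)
    show "complex_op.subspace {T :: 'a ell2_op. clinear_op T}"
      by (rule complex_op.subspaceI)
         (auto simp: clinear_op_def blinfun.add_left scaleC_op_apply scaleC_ell2_simps mult.commute)
    show "left_regular G s \<in> {T. clinear_op T}" if "s \<in> carrier G" for s
      using that by (auto simp: clinear_op_def left_regular_apply[OF is_group] scaleC_ell2.rep_eq
          intro!: ell2_eqI)
  qed
  then show "clinear_op T" using assms by auto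
  have "reduced_Cstar G \<subseteq> {T. \<forall>r \<xi>. r \<notin> carrier G \<longrightarrow> ell2_fun (blinfun_apply T \<xi>) r = 0}"
  proof (rule reduced_Cstar_subset)
    show "closed {T :: 'a ell2_op. \<forall>r \<xi>. r \<notin> carrier G \<longrightarrow> ell2_fun (blinfun_apply T \<xi>) r = 0}"
      by (intro closed_Collect_all closed_Collect_imp closed_Collect_eq cont) simp
    show "complex_op.subspace {T :: 'a ell2_op. \<forall>r \<xi>. r \<notin> carrier G \<longrightarrow> ell2_fun (blinfun_apply T \<xi>) r = 0}"
      by (rule complex_op.subspaceI)
         (auto simp: blinfun.add_left scaleC_op_apply zero_ell2.rep_eq plus_ell2.rep_eq scaleC_ell2.rep_eq)
  qed (auto simp: left_regular_apply[OF is_group])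
  then show "r \<notin> carrier G \<Longrightarrow> ell2_fun (blinfun_apply T \<xi>) r = 0" using assms by auto
  have "reduced_Cstar G \<subseteq> {T. \<forall>t. t \<notin> carrier G \<longrightarrow> blinfun_apply T (delta t) = 0}"
  proof (rule reduced_Cstar_subset)
    show "closed {T :: 'a ell2_op. \<forall>t. t \<notin> carrier G \<longrightarrow> blinfun_apply T (delta t) = 0}"
      by (intro closed_Collect_all closed_Collect_imp closed_Collect_eq cont) simp
    show "complex_op.subspace {T :: 'a ell2_op. \<forall>t. t \<notin> carrier G \<longrightarrow> blinfun_apply T (delta t) = 0}"
      by (rule complex_op.subspaceI) (auto simp: blinfun.add_left scaleC_op_apply scaleC_ell2_simps)
  qed (auto simp: left_regular_apply[OF is_group] delta.rep_eq zero_ell2.rep_eq intro!: ell2_eqI)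
  then show "t \<notin> carrier G \<Longrightarrow> blinfun_apply T (delta t) = 0" using assms by auto
  have "reduced_Cstar G \<subseteq> {T. \<forall>r t. r \<in> carrier G \<and> t \<in> carrier G \<longrightarrow>
      ell2_fun (blinfun_apply T (delta t)) r = fourier G T (r \<otimes> inv t)}"
  proof (rule reduced_Cstar_subset)
    show "closed {T :: 'a ell2_op. \<forall>r t. r \<in> carrier G \<and> t \<in> carrier G \<longrightarrow>
        ell2_fun (blinfun_apply T (delta t)) r = fourier G T (r \<otimes> inv t)}"
      unfolding fourier_def
      by (intro closed_Collect_all closed_Collect_imp closed_Collect_eq cont) simp
    show "complex_op.subspace {T :: 'a ell2_op. \<forall>r t. r \<in> carrier G \<and> t \<in> carrier G \<longrightarrow>
        ell2_fun (blinfun_apply T (delta t)) r = fourier G T (r \<otimes> inv t)}"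
      by (rule complex_op.subspaceI)
         (auto simp: blinfun.add_left scaleC_op_apply fourier_add fourier_scaleC fourier_zero
           zero_ell2.rep_eq plus_ell2.rep_eq scaleC_ell2.rep_eq)
    show "left_regular G s \<in> {T. \<forall>r t. r \<in> carrier G \<and> t \<in> carrier G \<longrightarrow>
        ell2_fun (blinfun_apply T (delta t)) r = fourier G T (r \<otimes> inv t)}" if s: "s \<in> carrier G" for s
    proof -
      have "r \<otimes> inv t = s \<longleftrightarrow> r = s \<otimes> t" if "r \<in> carrier G" "t \<in> carrier G" for r t
        using s that by (metis inv_closed inv_inv inv_solve_right)
      then show ?thesis
        using s by (auto simp: fourier_def left_regular_delta delta.rep_eq)
    qed
  qed
  then show "r \<in> carrier G \<Longrightarrow> t \<in> carrier G \<Longrightarrow>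
      ell2_fun (blinfun_apply T (delta t)) r = fourier G T (r \<otimes> inv t)" using assms by auto
qed

lemma fourier_left_regular:
  "s \<in> carrier G \<Longrightarrow> fourier G (left_regular G s) r = (if r = s then 1 else 0)"
  by (simp add: fourier_def left_regular_delta delta.rep_eq)

lemma reduced_Cstar_apply_sum_delta:
  assumes T: "T \<in> reduced_Cstar G" and F: "F \<subseteq> carrier G" and r: "r \<in> carrier G"
  shows "ell2_fun (blinfun_apply T (\<Sum>t\<in>F. scaleC_ell2 (z t) (delta t))) r
      = (\<Sum>t\<in>F. fourier G T (r \<otimes> inv t) * z t)"
  using reduced_Cstar_clinear[OF T] reduced_Cstar_delta[OF T r] F
  by (auto simp: blinfun.sum_right clinear_op_def ell2_fun_sum scaleC_ell2.rep_eq mult.commute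
      intro!: sum.cong)

text \<open>Testing on vectors supported in \<open>F\<close> and reading only the coordinates in
  \<open>F\<close> compresses \<open>T\<close> to a finite scalar matrix, and compression does not
  increase the norm.\<close>

lemma fourier_matrix_bound:
  fixes n :: nat
  assumes T: "\<And>i j. i < n \<Longrightarrow> j < n \<Longrightarrow> T i j \<in> reduced_Cstar G"
    and K: "op_matrix_bound {..<n} T K" "0 \<le> K" and F: "finite F" "F \<subseteq> carrier G"
  shows "L2_set (\<lambda>p. cmod (\<Sum>q\<in>{..<n} \<times> F.
            fourier G (T (fst p) (fst q)) (snd p \<otimes> inv (snd q)) * z q)) ({..<n} \<times> F)
      \<le> K * L2_set (\<lambda>q. cmod (z q)) ({..<n} \<times> F)"
proof -
  define \<xi> where "\<xi> j = (\<Sum>t\<in>F. scaleC_ell2 (z (j, t)) (delta t))" for j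
  define \<eta> where "\<eta> i = (\<Sum>j<n. blinfun_apply (T i j) (\<xi> j))" for i
  have eq: "ell2_fun (\<eta> i) r = (\<Sum>q\<in>{..<n} \<times> F. fourier G (T i (fst q)) (r \<otimes> inv (snd q)) * z q)"
    if "i < n" "r \<in> F" for i r
    using that T F subsetD[OF F(2) that(2)]
    by (auto simp: \<eta>_def \<xi>_def ell2_fun_sum sum.cartesian_product' reduced_Cstar_apply_sum_delta
        intro!: sum.cong)
  have "L2_set (\<lambda>p. cmod (\<Sum>q\<in>{..<n} \<times> F.
            fourier G (T (fst p) (fst q)) (snd p \<otimes> inv (snd q)) * z q)) ({..<n} \<times> F)
      = L2_set (\<lambda>p. cmod (ell2_fun (\<eta> (fst p)) (snd p))) ({..<n} \<times> F)"
    by (rule L2_set_cong) (auto simp: eq)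
  also have "\<dots> \<le> L2_set (\<lambda>i. norm (\<eta> i)) {..<n}"
    unfolding L2_set_Times using F by (intro L2_set_mono) (auto simp: L2_set_ell2_fun_le)
  also have "\<dots> \<le> K * L2_set (\<lambda>j. norm (\<xi> j)) {..<n}"
    unfolding \<eta>_def using K(1) by (rule op_matrix_boundD)
  also have "\<dots> = K * L2_set (\<lambda>q. cmod (z q)) ({..<n} \<times> F)"
    using F by (simp add: L2_set_Times \<xi>_def norm_sum_delta)
  finally show ?thesis .
qed

text \<open>Converse of \<open>fourier_matrix_bound\<close>: truncations of the test vectors
  converge to them, and the assumed bound is the same for every finite set.\<close>

lemma op_matrix_bound_of_fourier:
  fixes n :: nat
  assumes T: "\<And>i j. i < n \<Longrightarrow> j < n \<Longrightarrow> T i j \<in> reduced_Cstar G" and K: "0 \<le> K"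
    and bd: "\<And>F z. finite F \<Longrightarrow> F \<subseteq> carrier G \<Longrightarrow>
      L2_set (\<lambda>p. cmod (\<Sum>q\<in>{..<n} \<times> F.
            fourier G (T (fst p) (fst q)) (snd p \<otimes> inv (snd q)) * z q)) ({..<n} \<times> F)
      \<le> K * L2_set (\<lambda>q. cmod (z q)) ({..<n} \<times> F)"
  shows "op_matrix_bound {..<n} T K"
  unfolding op_matrix_bound_def
proof
  fix \<xi> :: "nat \<Rightarrow> 'a ell2"
  let ?T = "finite_subsets_at_top (UNIV :: 'a set)"
  let ?N = "L2_set (\<lambda>j. norm (\<xi> j)) {..<n}"
  show "L2_set (\<lambda>i. norm (\<Sum>j<n. blinfun_apply (T i j) (\<xi> j))) {..<n} \<le> K * ?N"
  proof (rule L2_set_norm_le_of_finite)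
    fix E :: "'a set" assume E: "finite E"
    define \<eta> where "\<eta> F i = (\<Sum>j<n. blinfun_apply (T i j) (truncate_ell2 F (\<xi> j)))" for F i
    have "((\<lambda>F. L2_set (\<lambda>p. cmod (ell2_fun (\<eta> F (fst p)) (snd p))) ({..<n} \<times> E)) \<longlongrightarrow>
        L2_set (\<lambda>p. cmod (ell2_fun (\<Sum>j<n. blinfun_apply (T (fst p) j) (\<xi> j)) (snd p))) ({..<n} \<times> E)) ?T"
      unfolding L2_set_def \<eta>_def
      by (intro tendsto_intros bounded_linear.tendsto[OF bounded_linear_ell2_fun]
          bounded_linear.tendsto[OF blinfun.bounded_linear_right] truncate_ell2_tendsto)
    moreover have "\<forall>\<^sub>F F in ?T. L2_set (\<lambda>p. cmod (ell2_fun (\<eta> F (fst p)) (snd p))) ({..<n} \<times> E) \<le> K * ?N"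
      unfolding eventually_finite_subsets_at_top
    proof (intro exI[of _ E] conjI allI impI)
      \<comment> \<open>Since \<open>F\<close> contains the output window \<open>E\<close>, the
        window can be enlarged to \<open>F\<close>; rows and columns then range over the same finite
        set.\<close>
      fix F assume F: "finite F \<and> E \<subseteq> F \<and> F \<subseteq> UNIV"
      \<comment> \<open>Rows and columns off the group vanish, so only the part of \<open>F\<close>
        inside it remains.\<close>
      define H where "H = F \<inter> carrier G"
      have H: "finite H" "H \<subseteq> carrier G" using F by (auto simp: H_def)
      define z where "z q = ell2_fun (\<xi> (fst q)) (snd q)" for q
      have trunc: "blinfun_apply (T i j) (truncate_ell2 F (\<xi> j))
          = blinfun_apply (T i j) (\<Sum>t\<in>H. scaleC_ell2 (z (j, t)) (delta t))" if "i < n" "j < n" for i j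
      proof -
        have "clinear_op (T i j)" "\<And>t. t \<notin> carrier G \<Longrightarrow> blinfun_apply (T i j) (delta t) = 0"
          using reduced_Cstar_clinear reduced_Cstar_delta_outside T that by blast+
        then show ?thesis
          unfolding truncate_ell2_def blinfun.sum_right z_def H_def fst_conv snd_conv using F
          by (intro sum.mono_neutral_right) (auto simp: clinear_op_def scaleC_ell2_simps)
      qed
      have eq: "ell2_fun (\<eta> F i) r = (\<Sum>q\<in>{..<n} \<times> H. fourier G (T i (fst q)) (r \<otimes> inv (snd q)) * z q)"
        if "i < n" "r \<in> carrier G" for i r
        using that T H
        by (auto simp: \<eta>_def trunc ell2_fun_sum sum.cartesian_product' reduced_Cstar_apply_sum_delta
            intro!: sum.cong)
      have zero: "ell2_fun (\<eta> F i) r = 0" if "i < n" "r \<notin> carrier G" for i r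
        using that T by (simp add: \<eta>_def ell2_fun_sum reduced_Cstar_apply_outside)
      have "L2_set (\<lambda>p. cmod (ell2_fun (\<eta> F (fst p)) (snd p))) ({..<n} \<times> E)
          \<le> L2_set (\<lambda>p. cmod (ell2_fun (\<eta> F (fst p)) (snd p))) ({..<n} \<times> F)"
        unfolding L2_set_def using F by (intro real_sqrt_le_mono sum_mono2) auto
      also have "\<dots> = L2_set (\<lambda>p. cmod (ell2_fun (\<eta> F (fst p)) (snd p))) ({..<n} \<times> H)"
        unfolding L2_set_def using F
        by (intro arg_cong[of _ _ sqrt] sum.mono_neutral_right) (auto simp: H_def, metis zero)
      also have "\<dots> = L2_set (\<lambda>p. cmod (\<Sum>q\<in>{..<n} \<times> H.
            fourier G (T (fst p) (fst q)) (snd p \<otimes> inv (snd q)) * z q)) ({..<n} \<times> H)"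
        using H by (intro L2_set_cong) (auto simp: eq)
      also have "\<dots> \<le> K * L2_set (\<lambda>q. cmod (z q)) ({..<n} \<times> H)"
        using H by (rule bd)
      also have "\<dots> \<le> K * ?N"
        unfolding L2_set_Times z_def using K H
        by (intro mult_left_mono L2_set_mono) (auto simp: L2_set_ell2_fun_le)
      finally show "L2_set (\<lambda>p. cmod (ell2_fun (\<eta> F (fst p)) (snd p))) ({..<n} \<times> E) \<le> K * ?N" .
    qed (use E in auto)
    ultimately have "L2_set (\<lambda>p. cmod (ell2_fun (\<Sum>j<n. blinfun_apply (T (fst p) j) (\<xi> j)) (snd p)))
        ({..<n} \<times> E) \<le> K * ?N"
      by (rule tendsto_upperbound) simp
    then show "L2_set (\<lambda>(i, r). cmod (ell2_fun (\<Sum>j<n. blinfun_apply (T i j) (\<xi> j)) r)) ({..<n} \<times> E) \<le> K * ?N"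
      by (simp add: case_prod_unfold)
  qed simp
qed

text \<open>Conjugation by the diagonal unitary with entries \<open>\<lambda>\<^sub>r\<close> turns the scalar matrix of Fourier
  coefficients of \<open>T\<^sub>i\<^sub>j\<close> at \<open>w = rt\<^sup>-\<^sup>1\<close> into the same matrix with \<open>\<lambda>\<^sub>w\<close> attached, to which \<open>S\<close> can be
  applied; testing the result on the vectors \<open>z(j,t) \<delta>\<^sub>t\<close> and reading off the coefficient at \<open>r\<close> gives
  the matrix of \<open>U\<close>.\<close>
lemma averaged_matrix_bound:
  fixes n :: nat
  assumes S: "cb_bound (reduced_Cstar G) S C" "0 \<le> C"
      "\<And>x. x \<in> reduced_Cstar G \<Longrightarrow> S x \<in> reduced_Cstar G"
      "\<And>c x. x \<in> reduced_Cstar G \<Longrightarrow> S (c *\<^sub>C x) = c *\<^sub>C S x"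
    and T: "\<And>i j. i < n \<Longrightarrow> j < n \<Longrightarrow> T i j \<in> reduced_Cstar G" "op_matrix_bound {..<n} T 1"
    and U: "\<And>i j. i < n \<Longrightarrow> j < n \<Longrightarrow> U i j \<in> reduced_Cstar G"
      "\<And>i j s. i < n \<Longrightarrow> j < n \<Longrightarrow> s \<in> carrier G \<Longrightarrow>
         fourier G (U i j) s = fourier G (S (left_regular G s)) s * fourier G (T i j) s"
  shows "op_matrix_bound {..<n} U C"
proof (rule op_matrix_bound_of_fourier[OF U(1) S(2)])
  fix F and z :: "nat \<times> 'a \<Rightarrow> complex"
  assume F: "finite F" "F \<subseteq> carrier G"
  let ?I = "{..<n} \<times> F"
  define w where "w p q = snd p \<otimes> inv (snd q)" for p q :: "nat \<times> 'a"
  define c where "c p q = fourier G (T (fst p) (fst q)) (w p q)" for p q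
  define b where "b p q = c p q *\<^sub>C left_regular G (w p q)" for p q
  have w: "w p q \<in> carrier G" if "p \<in> ?I" "q \<in> ?I" for p q
    using that F by (auto simp: w_def intro!: m_closed inv_closed)
  have b: "op_matrix_bound ?I b 1"
    unfolding op_matrix_bound_def
  proof
    fix \<zeta> :: "nat \<times> 'a \<Rightarrow> 'a ell2"
    define \<zeta>' where "\<zeta>' q = blinfun_apply (left_regular G (inv (snd q))) (\<zeta> q)" for q
    have "L2_set (\<lambda>p. norm (\<Sum>q\<in>?I. blinfun_apply (b p q) (\<zeta> q))) ?I
        \<le> L2_set (\<lambda>p. norm (\<Sum>q\<in>?I. scaleC_ell2 (c p q) (\<zeta>' q))) ?I"
    proof (rule L2_set_mono)
      fix p assume p: "p \<in> ?I"
      then have sp: "snd p \<in> carrier G" using F by auto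
      have "blinfun_apply (b p q) (\<zeta> q)
          = blinfun_apply (left_regular G (snd p)) (scaleC_ell2 (c p q) (\<zeta>' q))" if "q \<in> ?I" for q
      proof -
        have "snd q \<in> carrier G" using that F by auto
        then show ?thesis
          using sp reduced_Cstar_clinear[OF left_regular_in[OF sp]]
          by (simp add: b_def scaleC_op_apply \<zeta>'_def clinear_op_def left_regular_mult w_def)
      qed
      then have "(\<Sum>q\<in>?I. blinfun_apply (b p q) (\<zeta> q))
          = blinfun_apply (left_regular G (snd p)) (\<Sum>q\<in>?I. scaleC_ell2 (c p q) (\<zeta>' q))"
        by (simp add: blinfun.sum_right)
      then show "norm (\<Sum>q\<in>?I. blinfun_apply (b p q) (\<zeta> q)) \<le> norm (\<Sum>q\<in>?I. scaleC_ell2 (c p q) (\<zeta>' q))"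
        using norm_left_regular_apply_le[OF sp] by simp
    qed simp
    also have "\<dots> \<le> 1 * L2_set (\<lambda>q. norm (\<zeta>' q)) ?I"
      using F fourier_matrix_bound[OF T _ F]
      by (intro scalar_matrix_amplification) (auto simp: c_def w_def)
    also have "\<dots> \<le> 1 * L2_set (\<lambda>q. norm (\<zeta> q)) ?I"
      using F by (intro mult_left_mono L2_set_mono) (auto simp: \<zeta>'_def norm_left_regular_apply_le)
    finally show "L2_set (\<lambda>p. norm (\<Sum>q\<in>?I. blinfun_apply (b p q) (\<zeta> q))) ?I
        \<le> 1 * L2_set (\<lambda>q. norm (\<zeta> q)) ?I" .
  qed
  have Sb: "op_matrix_bound ?I (\<lambda>p q. S (b p q)) C"
    using F b w complex_op.subspace_scale[OF subspace_reduced_Cstar] left_regular_in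
    by (intro cb_bound_finite_index[OF S(1) _ _ b]) (auto simp: b_def)
  define \<zeta> where "\<zeta> q = scaleC_ell2 (z q) (delta (snd q))" for q
  have coeff: "ell2_fun (blinfun_apply (S (b p q)) (\<zeta> q)) (snd p) = fourier G (U (fst p) (fst q)) (w p q) * z q"
    if p: "p \<in> ?I" and q: "q \<in> ?I" for p q
  proof -
    have SX: "S (left_regular G (w p q)) \<in> reduced_Cstar G"
      by (intro S left_regular_in w p q)
    have "S (b p q) = c p q *\<^sub>C S (left_regular G (w p q))"
      unfolding b_def by (intro S left_regular_in w p q)
    moreover have "ell2_fun (blinfun_apply (S (left_regular G (w p q))) (delta (snd q))) (snd p)
        = fourier G (S (left_regular G (w p q))) (w p q)"
      unfolding w_def by (rule reduced_Cstar_delta) (use SX p q F in \<open>auto simp: w_def\<close>)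
    moreover have "fourier G (U (fst p) (fst q)) (w p q)
        = fourier G (S (left_regular G (w p q))) (w p q) * c p q"
      unfolding c_def using p q w by (intro U) auto
    ultimately show ?thesis
      using reduced_Cstar_clinear[OF SX]
      by (simp add: scaleC_op_apply scaleC_ell2.rep_eq \<zeta>_def clinear_op_def)
  qed
  have "L2_set (\<lambda>p. cmod (\<Sum>q\<in>?I. fourier G (U (fst p) (fst q)) (w p q) * z q)) ?I
      \<le> L2_set (\<lambda>p. norm (\<Sum>q\<in>?I. blinfun_apply (S (b p q)) (\<zeta> q))) ?I"
  proof (rule L2_set_mono)
    fix p assume "p \<in> ?I"
    then have "(\<Sum>q\<in>?I. fourier G (U (fst p) (fst q)) (w p q) * z q)
        = ell2_fun (\<Sum>q\<in>?I. blinfun_apply (S (b p q)) (\<zeta> q)) (snd p)"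
      unfolding ell2_fun_sum by (intro sum.cong refl coeff[symmetric])
    then show "cmod (\<Sum>q\<in>?I. fourier G (U (fst p) (fst q)) (w p q) * z q)
        \<le> norm (\<Sum>q\<in>?I. blinfun_apply (S (b p q)) (\<zeta> q))"
      using cmod_ell2_fun_le by metis
  qed simp
  also have "\<dots> \<le> C * L2_set (\<lambda>q. norm (\<zeta> q)) ?I"
    using Sb by (rule op_matrix_boundD)
  also have "\<dots> = C * L2_set (\<lambda>q. cmod (z q)) ?I"
    by (simp add: \<zeta>_def norm_scaleC_ell2 norm_delta)
  finally show "L2_set (\<lambda>p. cmod (\<Sum>q\<in>?I. fourier G (U (fst p) (fst q)) (snd p \<otimes> inv (snd q)) * z q)) ?I
      \<le> C * L2_set (\<lambda>q. cmod (z q)) ?I"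
    by (simp add: w_def)
qed

end

section \<open>Finitely supported multipliers\<close>

text \<open>Taking the transitive rather than the reflexive closure gives every block positive
  length, so the block starts \<open>g k\<close> are strictly increasing.\<close>

lemma concatenate_paths:
  assumes "\<And>k. R\<^sup>+\<^sup>+ (b k) (b (Suc k))"
  shows "\<exists>(q :: nat \<Rightarrow> 'a) g. g 0 = (0 :: nat) \<and> strict_mono g \<and> (\<forall>k. q (g k) = b k) \<and> (\<forall>n. R (q n) (q (Suc n)))"
proof -
  have "\<exists>l p. l > 0 \<and> p 0 = b k \<and> p l = b (Suc k) \<and> (\<forall>i<l. R (p i) (p (Suc i)))" for k
    using assms[of k] unfolding tranclp_power relpowp_fun_conv by blast
  then obtain l p where l: "\<And>k. l k > 0"
    and p: "\<And>k. p k 0 = b k" "\<And>k. p k (l k) = b (Suc k)" "\<And>k i. i < l k \<Longrightarrow> R (p k i) (p k (Suc i))"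
    by metis
  define g where "g k = (\<Sum>i<k. l i)" for k
  have g: "strict_mono g" using l by (simp add: strict_mono_Suc_iff g_def)
  have gSuc: "g (Suc k) = g k + l k" for k by (simp add: g_def)
  \<comment> \<open>\<open>K n\<close> is the block that contains time \<open>n\<close>.\<close>
  define K where "K n = (LEAST k. n < g (Suc k))" for n
  have K: "K (g k + i) = k" if "i < l k" for k i
    unfolding K_def
  proof (rule Least_equality)
    show "g k + i < g (Suc k)" using that by (simp add: gSuc)
    show "k \<le> j" if "g k + i < g (Suc j)" for j
    proof -
      have "g k < g (Suc j)" using that by simp
      then show ?thesis using strict_mono_less[OF g] by simp
    qed
  qed
  have decompose: "\<exists>k i. i < l k \<and> n = g k + i" for n
  proof (induction n)
    case 0
    show ?case using l[of 0] by (intro exI[of _ 0]) (simp add: g_def)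
  next
    case (Suc n)
    then obtain k i where ki: "i < l k" "n = g k + i" by blast
    show ?case
    proof (cases "Suc i < l k")
      case True
      then show ?thesis using ki by (intro exI[of _ k] exI[of _ "Suc i"]) simp
    next
      case False
      then show ?thesis using ki l[of "Suc k"]
        by (intro exI[of _ "Suc k"] exI[of _ 0]) (simp add: gSuc)
    qed
  qed
  define q where "q n = p (K n) (n - g (K n))" for n
  have q: "q (g k + i) = p k i" if "i < l k" for k i
    using K[OF that] by (simp add: q_def)
  have qg: "q (g k) = b k" for k
    using q[of 0 k] l p by simp
  have "R (q n) (q (Suc n))" for n
  proof -
    obtain k i where ki: "i < l k" "n = g k + i" using decompose by blast
    show ?thesis
    proof (cases "Suc i < l k")
      case True
      then show ?thesis using q[of i k] q[of "Suc i" k] ki p(3)[of i k] by simp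
    next
      case False
      then have "Suc i = l k" using ki by simp
      \<comment> \<open>By construction this value is read off as the start of block
        \<open>Suc k\<close>; it agrees with the end of block \<open>k\<close> because both are
        \<open>b (Suc k)\<close>.\<close>
      then have "q (Suc n) = p k (Suc i)"
        using qg[of "Suc k"] p(2)[of k] ki by (simp add: gSuc flip: add_Suc_right)
      then show ?thesis using q[of i k] ki p(3)[of i k] by simp
    qed
  qed
  moreover have "g 0 = 0" by (simp add: g_def)
  ultimately show ?thesis using g qg by blast
qed

text \<open>An infinite support makes the sum 0 by convention; hence the finiteness hypotheses
  wherever its values are computed.\<close>

definition multiplier_op :: "('a, 'b) monoid_scheme \<Rightarrow> ('a \<Rightarrow> complex) \<Rightarrow> 'a ell2_op \<Rightarrow> 'a ell2_op" where
  "multiplier_op G \<phi> y = (\<Sum>s | s \<in> carrier G \<and> \<phi> s \<noteq> 0. (\<phi> s * fourier G y s) *\<^sub>C left_regular G s)"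

lemma multiplier_op_eq_sum:
  assumes "finite A" "A \<subseteq> carrier G" "\<And>s. s \<in> carrier G \<Longrightarrow> \<phi> s \<noteq> 0 \<Longrightarrow> s \<in> A"
  shows "multiplier_op G \<phi> y = (\<Sum>s\<in>A. (\<phi> s * fourier G y s) *\<^sub>C left_regular G s)"
  unfolding multiplier_op_def using assms by (intro sum.mono_neutral_left) auto

lemma multiplier_op_add: "multiplier_op G \<phi> (x + y) = multiplier_op G \<phi> x + multiplier_op G \<phi> y"
  by (simp add: multiplier_op_def fourier_add distrib_left complex_op.scale_left_distrib sum.distrib)

lemma multiplier_op_scaleC: "multiplier_op G \<phi> (c *\<^sub>C y) = c *\<^sub>C multiplier_op G \<phi> y"
  by (simp add: multiplier_op_def fourier_scaleC complex_op.scale_sum_right mult_ac)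

lemma bounded_clinear_self_map_tendsto:
  assumes m: "bounded_clinear_self_map X m" and X: "complex_op.subspace X"
    and y: "\<And>n. y n \<in> X" "x \<in> X" "y \<longlonglongrightarrow> x"
  shows "(\<lambda>n. m (y n)) \<longlonglongrightarrow> m x"
proof -
  obtain K where K: "\<And>x. x \<in> X \<Longrightarrow> norm (m x) \<le> K * norm x"
    using m unfolding bounded_clinear_self_map_def by blast
  have dX: "y n - x \<in> X" for n
    using X y by (intro complex_op.subspace_diff) auto
  have "m (y n) - m x = m (y n - x)" for n
  proof -
    have "m ((y n - x) + x) = m (y n - x) + m x"
      using m y dX[of n] unfolding bounded_clinear_self_map_def by blast
    then show ?thesis by simp
  qed
  then have "norm (m (y n) - m x) \<le> K * norm (y n - x)" for n
    using K[OF dX] by simp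
  moreover have "(\<lambda>n. K * norm (y n - x)) \<longlonglongrightarrow> 0"
    using tendsto_mult_left[OF tendsto_norm[OF LIM_zero[OF y(3)]], of K] by simp
  ultimately have "(\<lambda>n. m (y n) - m x) \<longlonglongrightarrow> 0"
    by (rule Lim_null_comparison[OF always_eventually[OF allI]])
  then show ?thesis by (rule LIM_zero_cancel)
qed

lemma ennreal_bound_of_SUP:
  fixes h :: "'i \<Rightarrow> ennreal"
  assumes "(SUP i\<in>I. h i) < \<infinity>"
  shows "\<exists>C\<ge>0. \<forall>i\<in>I. h i \<le> ennreal C"
proof (intro exI conjI ballI)
  show "0 \<le> enn2real (SUP i\<in>I. h i)" by simp
  show "h i \<le> ennreal (enn2real (SUP i\<in>I. h i))" if "i \<in> I" for i
    using SUP_upper[OF that, of h] assms by simp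
qed

section \<open>Density arguments and cb-norms of finitely supported multipliers\<close>

context group
begin

lemma closed_reduced_Cstar: "closed (reduced_Cstar G)"
  by (simp add: reduced_Cstar_def)

text \<open>The set where two continuous linear maps agree is a closed subspace. This identifies the
  maps \<open>m \<phi>\<close> supplied by weak amenability with the explicit
  \<open>multiplier_op G \<phi>\<close>.\<close>

lemma bounded_clinear_self_map_unique:
  assumes m: "bounded_clinear_self_map (reduced_Cstar G) m" "bounded_clinear_self_map (reduced_Cstar G) m'"
    and eq: "\<And>s. s \<in> carrier G \<Longrightarrow> m (left_regular G s) = m' (left_regular G s)"
    and y: "y \<in> reduced_Cstar G"
  shows "m y = m' y"
proof -
  note X = subspace_reduced_Cstar
  let ?Q = "{y \<in> reduced_Cstar G. m y = m' y}"
  have "reduced_Cstar G \<subseteq> ?Q"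
  proof (rule reduced_Cstar_subset)
    show "closed ?Q"
      unfolding closed_sequential_limits
    proof safe
      fix x l assume x: "\<forall>n. x n \<in> ?Q" and l: "x \<longlonglongrightarrow> l"
      show lX: "l \<in> reduced_Cstar G"
        using closed_sequentially[OF closed_reduced_Cstar _ l] x by blast
      have xX: "x n \<in> reduced_Cstar G" for n using x by blast
      have "(\<lambda>n. m (x n)) \<longlonglongrightarrow> m l" "(\<lambda>n. m' (x n)) \<longlonglongrightarrow> m' l"
        by (rule bounded_clinear_self_map_tendsto[OF _ X xX lX l], fact)+
      moreover have "(\<lambda>n. m (x n)) = (\<lambda>n. m' (x n))" using x by auto
      ultimately show "m l = m' l" by (metis LIMSEQ_unique)
    qed
    show "complex_op.subspace ?Q"
    proof (rule complex_op.subspaceI)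
      have "m (0 *\<^sub>C 0) = 0 *\<^sub>C m 0" "m' (0 *\<^sub>C 0) = 0 *\<^sub>C m' 0"
        using m complex_op.subspace_0[OF X] unfolding bounded_clinear_self_map_def by blast+
      then show "0 \<in> ?Q" using complex_op.subspace_0[OF X] by simp
      show "x + y \<in> ?Q" if "x \<in> ?Q" "y \<in> ?Q" for x y
        using that m complex_op.subspace_add[OF X] by (simp add: bounded_clinear_self_map_def)
      show "c *\<^sub>C x \<in> ?Q" if "x \<in> ?Q" for c x
        using that m complex_op.subspace_scale[OF X] by (simp add: bounded_clinear_self_map_def)
    qed
  qed (auto simp: eq left_regular_in)
  then show ?thesis using y by blast
qed

text \<open>The uniform bound \<open>C\<close> lets convergence pass to norm limits, so the elements
  on which \<open>u n\<close> tends to the identity form a closed subspace.\<close>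

lemma tendsto_identity_on_reduced_Cstar:
  assumes add: "\<And>n x y. u n (x + y) = u n x + u n y" and scale: "\<And>n c x. u n (c *\<^sub>C x) = c *\<^sub>C u n x"
    and bound: "\<And>n x. x \<in> reduced_Cstar G \<Longrightarrow> norm (u n x) \<le> C * norm x"
    and gen: "\<And>s. s \<in> carrier G \<Longrightarrow> (\<lambda>n. u n (left_regular G s)) \<longlonglongrightarrow> left_regular G s"
    and y: "y \<in> reduced_Cstar G"
  shows "(\<lambda>n. u n y) \<longlonglongrightarrow> y"
proof -
  note X = subspace_reduced_Cstar
  let ?Q = "{y \<in> reduced_Cstar G. (\<lambda>n. u n y) \<longlonglongrightarrow> y}"
  have u0: "u n 0 = 0" for n using scale[of n 0 0] by simp
  have diff: "u n (x - y) = u n x - u n y" for n x y using add[of n "x - y" y] by simp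
  have "reduced_Cstar G \<subseteq> ?Q"
  proof (rule reduced_Cstar_subset)
    have "x \<in> ?Q" if x: "x \<in> closure ?Q" for x
    proof -
      have xX: "x \<in> reduced_Cstar G"
        using x closure_minimal[OF _ closed_reduced_Cstar, of ?Q] by blast
      have "(\<lambda>n. u n x) \<longlonglongrightarrow> x"
      proof (rule LIMSEQ_I)
        fix e :: real assume e: "0 < e"
        \<comment> \<open>The factor \<open>\<bar>C\<bar> + 1\<close> is positive whatever the sign
          of \<open>C\<close>, and pays for \<open>u n (x - z)\<close> and \<open>x - z\<close>
          together.\<close>
        define d where "d = e / (2 * (\<bar>C\<bar> + 1))"
        have d: "d > 0" using e by (simp add: d_def)
        then obtain z where z: "z \<in> ?Q" "dist z x < d"
          using x unfolding closure_approachable by blast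
        then obtain N where N: "\<And>n. n \<ge> N \<Longrightarrow> norm (u n z - z) < e / 2"
          using LIMSEQ_D[of "\<lambda>n. u n z" z "e / 2"] e by auto
        have "norm (u n x - x) < e" if "n \<ge> N" for n
        proof -
          have xz: "norm (x - z) < d" using z by (simp add: dist_norm norm_minus_commute)
          have "norm (u n (x - z)) \<le> C * norm (x - z)"
            using xX z by (intro bound complex_op.subspace_diff[OF X]) auto
          also have "\<dots> \<le> \<bar>C\<bar> * norm (x - z)" by (intro mult_right_mono) auto
          finally have "norm (u n (x - z)) + norm (x - z) \<le> (\<bar>C\<bar> + 1) * norm (x - z)"
            by (simp add: algebra_simps)
          also have "\<dots> \<le> (\<bar>C\<bar> + 1) * d" using xz by (intro mult_left_mono) auto
          also have "\<dots> = e / 2" by (simp add: d_def field_simps)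
          finally have 1: "norm (u n (x - z)) + norm (x - z) \<le> e / 2" .
          have "u n x - x = u n (x - z) + (u n z - z) + (z - x)" by (simp add: diff)
          then have "norm (u n x - x) \<le> norm (u n (x - z)) + norm (u n z - z) + norm (z - x)"
            by (metis norm_add_rule_thm norm_triangle_ineq order_refl)
          then show ?thesis using 1 N[OF that] by (simp add: norm_minus_commute)
        qed
        then show "\<exists>N. \<forall>n\<ge>N. norm (u n x - x) < e" by blast
      qed
      then show ?thesis using xX by simp
    qed
    then show "closed ?Q" unfolding closure_subset_eq[symmetric] by (rule subsetI)
    show "complex_op.subspace ?Q"
    proof (rule complex_op.subspaceI)
      show "0 \<in> ?Q" using complex_op.subspace_0[OF X] by (simp add: u0)
      show "x + y \<in> ?Q" if "x \<in> ?Q" "y \<in> ?Q" for x y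
        using that complex_op.subspace_add[OF X] by (auto simp: add intro: tendsto_add)
      show "c *\<^sub>C x \<in> ?Q" if "x \<in> ?Q" for c x
        using that complex_op.subspace_scale[OF X]
        by (auto simp: scale intro: bounded_linear.tendsto[OF bounded_linear_scaleC_op])
    qed
  qed (auto simp: gen left_regular_in)
  then show ?thesis using y by blast
qed

lemma multiplier_op_in: "multiplier_op G \<phi> y \<in> reduced_Cstar G"
  unfolding multiplier_op_def
  by (intro complex_op.subspace_sum[OF subspace_reduced_Cstar]
      complex_op.subspace_scale[OF subspace_reduced_Cstar] left_regular_in) auto

lemma fourier_multiplier_op:
  assumes "finite {s \<in> carrier G. \<phi> s \<noteq> 0}" "s \<in> carrier G"
  shows "fourier G (multiplier_op G \<phi> y) s = \<phi> s * fourier G y s"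
proof -
  have "fourier G (multiplier_op G \<phi> y) s
      = (\<Sum>r | r \<in> carrier G \<and> \<phi> r \<noteq> 0. if s = r then \<phi> s * fourier G y s else 0)"
    unfolding multiplier_op_def fourier_sum fourier_scaleC
    by (intro sum.cong) (auto simp: fourier_left_regular)
  then show ?thesis using assms by simp
qed

lemma multiplier_op_left_regular:
  assumes "finite {s \<in> carrier G. \<phi> s \<noteq> 0}" "s \<in> carrier G"
  shows "multiplier_op G \<phi> (left_regular G s) = \<phi> s *\<^sub>C left_regular G s"
proof -
  have "multiplier_op G \<phi> (left_regular G s)
      = (\<Sum>r | r \<in> carrier G \<and> \<phi> r \<noteq> 0. if s = r then \<phi> s *\<^sub>C left_regular G s else 0)"
    unfolding multiplier_op_def by (intro sum.cong) (auto simp: fourier_left_regular assms)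
  then show ?thesis using assms by simp
qed

lemma is_multiplier_multiplier_op:
  assumes fin: "finite {s \<in> carrier G. \<phi> s \<noteq> 0}"
  shows "is_multiplier G \<phi> (multiplier_op G \<phi>)"
proof -
  have "norm (multiplier_op G \<phi> y) \<le> (\<Sum>s | s \<in> carrier G \<and> \<phi> s \<noteq> 0. cmod (\<phi> s)) * norm y" for y
    unfolding multiplier_op_def sum_distrib_right
  proof (intro order_trans[OF norm_sum] sum_mono)
    fix s assume "s \<in> {s. s \<in> carrier G \<and> \<phi> s \<noteq> 0}"
    then have "norm (left_regular G s) \<le> 1" by (simp add: norm_left_regular_le)
    then have "norm ((\<phi> s * fourier G y s) *\<^sub>C left_regular G s) \<le> cmod (\<phi> s * fourier G y s) * 1"
      by (intro order_trans[OF norm_scaleC_op_le] mult_left_mono) auto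
    also have "\<dots> \<le> cmod (\<phi> s) * norm y"
      using mult_left_mono[OF cmod_fourier_le[of G y s] norm_ge_zero[of "\<phi> s"]] by (simp add: norm_mult)
    finally show "norm ((\<phi> s * fourier G y s) *\<^sub>C left_regular G s) \<le> cmod (\<phi> s) * norm y" .
  qed
  then have "\<exists>K. \<forall>x\<in>reduced_Cstar G. norm (multiplier_op G \<phi> x) \<le> K * norm x" by blast
  then show ?thesis
    unfolding is_multiplier_def bounded_clinear_self_map_def
    using multiplier_op_left_regular[OF fin]
    by (simp add: multiplier_op_in multiplier_op_add multiplier_op_scaleC)
qed

text \<open>Each summand has rank one and cb-norm at most \<open>cmod (d s)\<close>. This triangle
  bound is cheap only for small \<open>d\<close>, which is why the path between two multipliers is
  cut into rounds.\<close>

lemma cb_bound_fourier_sum: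
  assumes "finite A" "A \<subseteq> carrier G"
  shows "cb_bound (reduced_Cstar G) (\<lambda>y. \<Sum>s\<in>A. (d s * fourier G y s) *\<^sub>C left_regular G s) (\<Sum>s\<in>A. cmod (d s))"
proof (rule cb_bound_sum[OF assms(1)])
  fix s assume "s \<in> A"
  then have s: "norm (left_regular G s) \<le> 1" using assms norm_left_regular_le by blast
  have "cb_bound (reduced_Cstar G) (\<lambda>y. fourier G y s *\<^sub>C left_regular G s) (1 * norm (left_regular G s))"
    using cmod_fourier_le reduced_Cstar_clinear
    by (intro cb_bound_rank_one subspace_reduced_Cstar fourier_op_dual) auto
  then have "cb_bound (reduced_Cstar G) (\<lambda>y. fourier G y s *\<^sub>C left_regular G s) 1"
    by (rule cb_bound_mono) (use s in simp)
  from cb_bound_scaleC[OF this, of "d s"]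
  show "cb_bound (reduced_Cstar G) (\<lambda>y. (d s * fourier G y s) *\<^sub>C left_regular G s) (cmod (d s))"
    by simp
qed

text \<open>Moving from \<open>\<phi>\<close> to \<open>\<phi>'\<close> in \<open>N\<close> rounds, each of which changes the values one point at a time by
  \<open>(\<phi>' - \<phi>) / N\<close>: for large \<open>N\<close> an incomplete round costs at most 1 in cb-norm.\<close>
lemma multiplier_path:
  fixes \<phi> \<phi>' :: "'a \<Rightarrow> complex" and C :: real
  defines "Q \<equiv> \<lambda>\<psi>. finite {s. \<psi> s \<noteq> 0} \<and> {s. \<psi> s \<noteq> 0} \<subseteq> carrier G \<and>
      cb_bound (reduced_Cstar G) (multiplier_op G \<psi>) (C + 1) \<and> (\<forall>s. \<psi> s \<in> closed_segment (\<phi> s) (\<phi>' s))"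
  assumes \<phi>: "finite {s. \<phi> s \<noteq> 0}" "{s. \<phi> s \<noteq> 0} \<subseteq> carrier G"
      "cb_bound (reduced_Cstar G) (multiplier_op G \<phi>) C"
    and \<phi>': "finite {s. \<phi>' s \<noteq> 0}" "{s. \<phi>' s \<noteq> 0} \<subseteq> carrier G"
      "cb_bound (reduced_Cstar G) (multiplier_op G \<phi>') C"
  shows "(\<lambda>\<psi> \<psi>'. Q \<psi> \<and> Q \<psi>' \<and> (\<exists>s\<in>carrier G. \<forall>r. r \<noteq> s \<longrightarrow> \<psi>' r = \<psi> r))\<^sup>*\<^sup>* \<phi> \<phi>'"
    (is "?R\<^sup>*\<^sup>* \<phi> \<phi>'")
proof -
  define A where "A = {s. \<phi> s \<noteq> 0} \<union> {s. \<phi>' s \<noteq> 0}"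
  have A: "finite A" "A \<subseteq> carrier G" using \<phi> \<phi>' by (auto simp: A_def)
  define D where "D s = \<phi>' s - \<phi> s" for s
  have zero: "\<phi> s = 0" "\<phi>' s = 0" "D s = 0" if "s \<notin> A" for s using that by (auto simp: A_def D_def)
  obtain N0 :: nat where N0: "(\<Sum>s\<in>A. cmod (D s)) \<le> real N0" using real_arch_simple by blast
  \<comment> \<open>The successor makes \<open>N\<close> positive even when \<open>\<phi>\<close>
    and \<open>\<phi>'\<close> coincide.\<close>
  define N where "N = Suc N0"
  have N: "(\<Sum>s\<in>A. cmod (D s)) \<le> real N" "N > 0" using N0 by (auto simp: N_def)
  \<comment> \<open>In \<open>\<psi> j B\<close>, \<open>j\<close> rounds are complete and the
    points of \<open>B\<close> have already moved in the next one.\<close>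
  define \<psi> where "\<psi> j B s = \<phi> s + complex_of_real (real j / N + (if s \<in> B then 1 / N else 0)) * D s"
    for j B s
  have Q: "Q (\<psi> j B)" if j: "j < N" and B: "B \<subseteq> A" for j B
  proof -
    have supp: "\<psi> j B s = 0" if "s \<notin> A" for s using zero[OF that] by (simp add: \<psi>_def)
    define t where "t = real j / N"
    have t: "0 \<le> t" "t \<le> 1" "t + 1 / N \<le> 1" using j N by (auto simp: t_def field_simps)
    have finB: "finite B" using A B finite_subset by blast
    \<comment> \<open>The convex combination at \<open>t\<close> has cb-norm at most
      \<open>C\<close>. The remaining sum over \<open>B\<close> costs at most the sum of the
      \<open>cmod (D s)\<close> divided by \<open>N\<close>, hence at most 1.\<close>
    have eq: "multiplier_op G (\<psi> j B) y = complex_of_real (1 - t) *\<^sub>C multiplier_op G \<phi> y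
        + complex_of_real t *\<^sub>C multiplier_op G \<phi>' y
        + (\<Sum>s\<in>B. (complex_of_real (1 / N) * D s * fourier G y s) *\<^sub>C left_regular G s)" for y
    proof -
      have B_eq: "(\<Sum>s\<in>B. (complex_of_real (1 / N) * D s * fourier G y s) *\<^sub>C left_regular G s)
          = (\<Sum>s\<in>A. (complex_of_real (if s \<in> B then 1 / N else 0) * D s * fourier G y s) *\<^sub>C left_regular G s)"
        using A B by (intro sum.mono_neutral_cong_left) auto
      have A_eq: "multiplier_op G \<rho> y = (\<Sum>s\<in>A. (\<rho> s * fourier G y s) *\<^sub>C left_regular G s)"
        if "\<forall>s. s \<notin> A \<longrightarrow> \<rho> s = 0" for \<rho>
        using A that by (intro multiplier_op_eq_sum) auto
      have zeros: "\<forall>s. s \<notin> A \<longrightarrow> \<phi> s = 0" "\<forall>s. s \<notin> A \<longrightarrow> \<phi>' s = 0" "\<forall>s. s \<notin> A \<longrightarrow> \<psi> j B s = 0"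
        using zero supp by blast+
      show ?thesis
        unfolding B_eq zeros[THEN A_eq]
          complex_op.scale_sum_right complex_op.scale_scale sum.distrib[symmetric]
          complex_op.scale_left_distrib[symmetric]
        by (intro sum.cong refl arg_cong2[of _ _ _ _ scaleC_op])
           (simp only: \<psi>_def t_def[symmetric], simp add: D_def algebra_simps)
    qed
    have bd: "cb_bound (reduced_Cstar G) (\<lambda>y. complex_of_real (1 - t) *\<^sub>C multiplier_op G \<phi> y
        + complex_of_real t *\<^sub>C multiplier_op G \<phi>' y
        + (\<Sum>s\<in>B. (complex_of_real (1 / N) * D s * fourier G y s) *\<^sub>C left_regular G s))
        (cmod (complex_of_real (1 - t)) * C + cmod (complex_of_real t) * C
          + (\<Sum>s\<in>B. cmod (complex_of_real (1 / N) * D s)))"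
      using A B finB by (intro cb_bound_add cb_bound_scaleC \<phi> \<phi>' cb_bound_fourier_sum) auto
    have le: "cmod (complex_of_real (1 - t)) * C + cmod (complex_of_real t) * C
          + (\<Sum>s\<in>B. cmod (complex_of_real (1 / N) * D s)) \<le> C + 1"
    proof -
      have "(\<Sum>s\<in>B. cmod (complex_of_real (1 / N) * D s)) = (\<Sum>s\<in>B. cmod (D s)) / N"
        by (simp add: norm_mult norm_divide sum_divide_distrib)
      also have "\<dots> \<le> (\<Sum>s\<in>A. cmod (D s)) / N"
        using A B by (intro divide_right_mono sum_mono2) auto
      also have "\<dots> \<le> 1" using N by simp
      finally show ?thesis using t by (simp only: norm_of_real) (simp add: algebra_simps)
    qed
    have "cb_bound (reduced_Cstar G) (multiplier_op G (\<psi> j B)) (C + 1)"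
      using cb_bound_mono[OF bd le] by (subst cb_bound_cong[OF eq])
    \<comment> \<open>Because \<open>j < N\<close>, the extra \<open>1 / N\<close> does not
      overshoot the end of the segment.\<close>
    moreover have "\<psi> j B s \<in> closed_segment (\<phi> s) (\<phi>' s)" for s
    proof -
      define v where "v = t + (if s \<in> B then 1 / N else 0)"
      have "0 \<le> v" "v \<le> 1" using t by (auto simp: v_def)
      moreover have "\<psi> j B s = (1 - v) *\<^sub>R \<phi> s + v *\<^sub>R \<phi>' s"
        unfolding \<psi>_def t_def[symmetric] v_def[symmetric]
        by (simp add: D_def scaleR_conv_of_real algebra_simps)
      ultimately show ?thesis unfolding closed_segment_def by blast
    qed
    moreover have "{s. \<psi> j B s \<noteq> 0} \<subseteq> A" using supp by blast
    ultimately show ?thesis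
      unfolding Q_def using A finite_subset by blast
  qed
  have round: "?R\<^sup>*\<^sup>* (\<psi> j {}) (\<psi> j B)" if j: "j < N" and B: "B \<subseteq> A" for j B
    using finite_subset[OF B A(1)] B
  proof (induction B rule: finite_induct)
    case (insert s B)
    have "?R (\<psi> j B) (\<psi> j (insert s B))"
      using Q[OF j] insert A by (auto simp: \<psi>_def intro!: bexI[of _ s])
    moreover have "?R\<^sup>*\<^sup>* (\<psi> j {}) (\<psi> j B)" using insert by blast
    ultimately show ?case by (rule rtranclp.rtrancl_into_rtrancl[rotated])
  qed simp
  have complete: "\<psi> j A = \<psi> (Suc j) {}" for j
    using zero by (auto simp: \<psi>_def fun_eq_iff algebra_simps add_divide_distrib)
  have "?R\<^sup>*\<^sup>* (\<psi> 0 {}) (\<psi> j {})" if "j \<le> N" for j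
    using that
  proof (induction j)
    case (Suc j)
    have "?R\<^sup>*\<^sup>* (\<psi> 0 {}) (\<psi> j {})" using Suc by simp
    moreover have "?R\<^sup>*\<^sup>* (\<psi> j {}) (\<psi> (Suc j) {})"
      using round[of j A] Suc.prems by (simp only: complete)
    ultimately show ?case by (rule rtranclp_trans)
  qed simp
  from this[OF order_refl] have "?R\<^sup>*\<^sup>* (\<psi> 0 {}) (\<psi> N {})" .
  moreover have "\<psi> 0 {} = \<phi>" "\<psi> N {} = \<phi>'"
    using N by (auto simp: \<psi>_def D_def)
  ultimately show ?thesis by (simp only:)
qed

section \<open>Weak amenability and frames\<close>

lemma weakly_amenable_sequence:
  assumes "countable (carrier G)" "weakly_amenable G"
  shows "\<exists>C (\<phi> :: nat \<Rightarrow> 'a \<Rightarrow> complex). 0 \<le> C \<and>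
    (\<forall>k. finite {s. \<phi> k s \<noteq> 0} \<and> {s. \<phi> k s \<noteq> 0} \<subseteq> carrier G \<and>
         cb_bound (reduced_Cstar G) (multiplier_op G (\<phi> k)) C) \<and>
    (\<forall>s\<in>carrier G. (\<lambda>k. \<phi> k s) \<longlonglongrightarrow> 1)"
proof -
  obtain \<Phi> :: "('a \<Rightarrow> complex) set" and F m where F: "F \<noteq> bot" "F \<le> principal \<Phi>"
    and fin: "\<And>\<phi>. \<phi> \<in> \<Phi> \<Longrightarrow> finite {s \<in> carrier G. \<phi> s \<noteq> 0}"
    and lim: "\<And>s. s \<in> carrier G \<Longrightarrow> ((\<lambda>\<phi>. \<phi> s) \<longlongrightarrow> 1) F"
    and m: "\<And>\<phi>. \<phi> \<in> \<Phi> \<Longrightarrow> is_multiplier G \<phi> (m \<phi>)"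
    and bd: "(SUP \<phi>\<in>\<Phi>. cb_norm (reduced_Cstar G) (m \<phi>)) < \<infinity>"
    using assms(2) unfolding weakly_amenable_def by blast
  obtain C where C: "0 \<le> C" "\<And>\<phi>. \<phi> \<in> \<Phi> \<Longrightarrow> cb_norm (reduced_Cstar G) (m \<phi>) \<le> ennreal C"
    using ennreal_bound_of_SUP[OF bd] by blast
  have cb: "cb_bound (reduced_Cstar G) (multiplier_op G \<phi>) C" if \<phi>: "\<phi> \<in> \<Phi>" for \<phi>
  proof -
    have eq: "m \<phi> y = multiplier_op G \<phi> y" if "y \<in> reduced_Cstar G" for y
      using bounded_clinear_self_map_unique[of "m \<phi>" "multiplier_op G \<phi>" y] that m[OF \<phi>]
        is_multiplier_multiplier_op[OF fin[OF \<phi>]]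
      by (simp add: is_multiplier_def)
    have "cb_bound (reduced_Cstar G) (m \<phi>) C"
      using C \<phi> cb_norm_le_iff by blast
    moreover have "cb_bound (reduced_Cstar G) (m \<phi>) C = cb_bound (reduced_Cstar G) (multiplier_op G \<phi>) C"
      by (rule cb_bound_cong) (rule eq)
    ultimately show ?thesis by simp
  qed
  \<comment> \<open>This enumeration may repeat elements, so it also covers finite groups.\<close>
  define e where "e = from_nat_into (carrier G)"
  have ne: "carrier G \<noteq> {}" by auto
  have e: "e i \<in> carrier G" for i
    unfolding e_def using ne by (rule from_nat_into)
  \<comment> \<open>Closeness to 1 at the first \<open>k\<close> enumerated points is a finite
    conjunction of eventual properties, and \<open>F \<noteq> bot\<close> provides a function
    satisfying it.\<close>
  have "\<exists>\<phi>\<in>\<Phi>. \<forall>i<k. dist (\<phi> (e i)) 1 < inverse (real (Suc k))" for k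
  proof -
    have "\<forall>\<^sub>F \<phi> in F. \<forall>i\<in>{..<k}. dist (\<phi> (e i)) 1 < inverse (real (Suc k))"
      using tendstoD[OF lim[OF e]] by (intro eventually_ball_finite) auto
    moreover have "\<forall>\<^sub>F \<phi> in F. \<phi> \<in> \<Phi>"
      using F(2) by (simp add: le_principal)
    ultimately have "\<forall>\<^sub>F \<phi> in F. \<phi> \<in> \<Phi> \<and> (\<forall>i\<in>{..<k}. dist (\<phi> (e i)) 1 < inverse (real (Suc k)))"
      by eventually_elim simp
    from eventually_happens[OF this] F(1) show ?thesis by auto
  qed
  then obtain \<phi> where \<phi>: "\<And>k. \<phi> k \<in> \<Phi>"
    and close: "\<And>k i. i < k \<Longrightarrow> dist (\<phi> k (e i)) 1 < inverse (real (Suc k))"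
    by metis
  \<comment> \<open>Weak amenability controls the support inside the group only; zero values outside
    leave the multiplier unchanged and make the whole support finite.\<close>
  define \<psi> where "\<psi> k s = (if s \<in> carrier G then \<phi> k s else 0)" for k s
  have supp: "{s. \<psi> k s \<noteq> 0} = {s \<in> carrier G. \<phi> k s \<noteq> 0}" for k by (auto simp: \<psi>_def)
  show ?thesis
  proof (intro exI[of _ C] exI[of _ \<psi>] conjI allI ballI C(1))
    show "finite {s. \<psi> k s \<noteq> 0}" "{s. \<psi> k s \<noteq> 0} \<subseteq> carrier G" for k
      unfolding supp using fin[OF \<phi>] by auto
    have "multiplier_op G (\<psi> k) y = multiplier_op G (\<phi> k) y" for k y
      unfolding multiplier_op_def by (intro sum.cong) (auto simp: \<psi>_def)
    then have "multiplier_op G (\<psi> k) = multiplier_op G (\<phi> k)" for k by blast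
    then show "cb_bound (reduced_Cstar G) (multiplier_op G (\<psi> k)) C" for k
      using cb[OF \<phi>] by simp
    show "(\<lambda>k. \<psi> k s) \<longlonglongrightarrow> 1" if s: "s \<in> carrier G" for s
    proof -
      obtain i where i: "s = e i"
        using from_nat_into_surj[OF assms(1) s] by (auto simp: e_def)
      have "(\<lambda>k. dist (\<psi> k s) 1) \<longlonglongrightarrow> 0"
      proof (rule tendsto_sandwich[OF _ _ tendsto_const LIMSEQ_inverse_real_of_nat])
        show "\<forall>\<^sub>F k in sequentially. dist (\<psi> k s) 1 \<le> inverse (real (Suc k))"
          using eventually_gt_at_top[of i]
        proof eventually_elim
          case (elim k)
          then show ?case using close[of i k] s by (simp add: \<psi>_def i)
        qed
      qed simp
      then show ?thesis using tendsto_dist_iff by blast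
    qed
  qed
qed

lemma weakly_amenable_imp_cb_frame:
  assumes "countable (carrier G)" "weakly_amenable G"
  shows "has_cb_frame (reduced_Cstar G)"
proof -
  let ?X = "reduced_Cstar G"
  obtain C \<phi>0 where C: "0 \<le> C"
    and \<phi>0: "\<forall>k. finite {s. \<phi>0 k s \<noteq> 0} \<and> {s. \<phi>0 k s \<noteq> 0} \<subseteq> carrier G \<and>
         cb_bound ?X (multiplier_op G (\<phi>0 k)) C"
    and lim0: "\<forall>s\<in>carrier G. (\<lambda>k. \<phi>0 k s) \<longlonglongrightarrow> 1"
    using weakly_amenable_sequence[OF assms] by auto
  \<comment> \<open>The zero function is put in front because the empty partial sum of a frame is
    0.\<close>
  define \<phi> where "\<phi> k = (case k of 0 \<Rightarrow> (\<lambda>_. 0) | Suc k \<Rightarrow> \<phi>0 k)" for k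
  have "multiplier_op G (\<lambda>_. 0) = (\<lambda>_. 0)"
    by (simp add: multiplier_op_def fun_eq_iff)
  then have "cb_bound ?X (multiplier_op G (\<lambda>_. 0)) C"
    using cb_bound_mono[OF cb_bound_zero C] by simp
  then have \<phi>: "finite {s. \<phi> k s \<noteq> 0}" "{s. \<phi> k s \<noteq> 0} \<subseteq> carrier G"
    "cb_bound ?X (multiplier_op G (\<phi> k)) C" for k
    using \<phi>0 by (auto simp: \<phi>_def split: nat.split)
  have lim: "(\<lambda>k. \<phi> k s) \<longlonglongrightarrow> 1" if "s \<in> carrier G" for s
    by (rule LIMSEQ_imp_Suc) (use lim0 that in \<open>simp add: \<phi>_def\<close>)
  define Q where "Q k \<psi> \<longleftrightarrow> finite {s. \<psi> s \<noteq> 0} \<and> {s. \<psi> s \<noteq> 0} \<subseteq> carrier G \<and>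
      cb_bound ?X (multiplier_op G \<psi>) (C + 1) \<and> (\<forall>s. \<psi> s \<in> closed_segment (\<phi> k s) (\<phi> (Suc k) s))" for k \<psi>
  define R where "R k \<psi> \<psi>' \<longleftrightarrow> Q k \<psi> \<and> Q k \<psi>' \<and> (\<exists>s\<in>carrier G. \<forall>r. r \<noteq> s \<longrightarrow> \<psi>' r = \<psi> r)" for k \<psi> \<psi>'
  have path: "(R k)\<^sup>*\<^sup>* (\<phi> k) (\<phi> (Suc k))" for k
    using multiplier_path[of "\<phi> k" C "\<phi> (Suc k)"] \<phi> unfolding R_def[abs_def] Q_def by blast
  \<comment> \<open>States are pairs of a stage \<open>k\<close> and a function, so each time
    remembers which segment its values lie on. The second kind of step only advances the stage; it
    makes every block nonempty even if \<open>\<phi> k\<close> and \<open>\<phi> (Suc k)\<close> are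
    equal.\<close>
  define T where "T p p' \<longleftrightarrow> fst p' = fst p \<and> R (fst p) (snd p) (snd p') \<or>
      fst p' = Suc (fst p) \<and> snd p' = snd p \<and> snd p = \<phi> (Suc (fst p))" for p p'
  have "T\<^sup>+\<^sup>+ (k, \<phi> k) (Suc k, \<phi> (Suc k))" for k
  proof -
    have "T\<^sup>*\<^sup>* (k, \<phi> k) (k, \<psi>)" if "(R k)\<^sup>*\<^sup>* (\<phi> k) \<psi>" for \<psi>
      using that
    proof (induction rule: rtranclp_induct)
      case (step \<psi> \<psi>')
      have "T (k, \<psi>) (k, \<psi>')" using step by (simp add: T_def)
      then show ?case using step by (meson rtranclp.rtrancl_into_rtrancl)
    qed simp
    from this[OF path] have "T\<^sup>*\<^sup>* (k, \<phi> k) (k, \<phi> (Suc k))" .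
    moreover have "T (k, \<phi> (Suc k)) (Suc k, \<phi> (Suc k))" by (simp add: T_def)
    ultimately show ?thesis by (rule rtranclp_into_tranclp1)
  qed
  then obtain q g where g: "g 0 = 0" "strict_mono g" and qg: "\<And>k. q (g k) = (k, \<phi> k)"
    and q: "\<And>n. T (q n) (q (Suc n))"
    using concatenate_paths[of T "\<lambda>k. (k, \<phi> k)"] by auto
  define \<kappa> where "\<kappa> n = fst (q n)" for n
  define \<psi> where "\<psi> n = snd (q n)" for n
  \<comment> \<open>Needed when the outgoing step advances the stage, since such a step carries no
    information from \<open>R\<close>.\<close>
  have Qend: "Q k (\<phi> (Suc k))" for k
    using \<phi>[of "Suc k"] cb_bound_mono[of _ _ C "C + 1"] by (auto simp: Q_def)
  have Q: "Q (\<kappa> n) (\<psi> n)" for n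
    using q[of n] Qend[of "\<kappa> n"] by (auto simp: T_def R_def \<kappa>_def \<psi>_def)
  have fin: "finite {s. \<psi> n s \<noteq> 0}" "{s. \<psi> n s \<noteq> 0} \<subseteq> carrier G"
    and cb: "cb_bound ?X (multiplier_op G (\<psi> n)) (C + 1)"
    and seg: "\<psi> n s \<in> closed_segment (\<phi> (\<kappa> n) s) (\<phi> (Suc (\<kappa> n)) s)" for n s
    using Q[of n] by (auto simp: Q_def)
  have fin': "finite {s \<in> carrier G. \<psi> n s \<noteq> 0}" for n
    by (rule finite_subset[OF _ fin(1)[of n]]) auto
  \<comment> \<open>A step that advances the stage changes no value: any group element serves, and
    the corresponding frame term is zero.\<close>
  have "\<exists>s\<in>carrier G. \<forall>r. r \<noteq> s \<longrightarrow> \<psi> (Suc n) r = \<psi> n r" for n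
    using q[of n] by (auto simp: T_def R_def \<psi>_def)
  then obtain a where a: "\<And>n. a n \<in> carrier G" and a_eq: "\<And>n r. r \<noteq> a n \<Longrightarrow> \<psi> (Suc n) r = \<psi> n r"
    by metis
  have \<psi>0: "\<psi> 0 = (\<lambda>_. 0)"
    using qg[of 0] g by (simp add: \<psi>_def \<phi>_def)
  have "\<kappa> n \<le> \<kappa> (Suc n)" for n
    using q[of n] by (auto simp: T_def \<kappa>_def)
  then have "mono \<kappa>" by (simp add: mono_iff_le_Suc)
  have \<kappa>_ge: "k \<le> \<kappa> n" if "g k \<le> n" for k n
    using monoD[OF \<open>mono \<kappa>\<close> that] qg[of k] by (simp add: \<kappa>_def)
  have \<psi>_lim: "(\<lambda>n. \<psi> n s) \<longlonglongrightarrow> 1" if s: "s \<in> carrier G" for s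
  proof (rule tendstoI)
    fix e :: real assume "0 < e"
    then obtain K where K: "\<And>k. k \<ge> K \<Longrightarrow> dist (\<phi> k s) 1 < e"
      using tendstoD[OF lim[OF s]] unfolding eventually_sequentially by blast
    show "\<forall>\<^sub>F n in sequentially. dist (\<psi> n s) 1 < e"
      using eventually_ge_at_top[of "g K"]
    proof eventually_elim
      \<comment> \<open>Both ends of the current segment lie in the ball around 1, and balls are
        convex.\<close>
      case (elim n)
      then have "\<phi> (\<kappa> n) s \<in> ball 1 e" "\<phi> (Suc (\<kappa> n)) s \<in> ball 1 e"
        using K[of "\<kappa> n"] K[of "Suc (\<kappa> n)"] \<kappa>_ge[of K n] by (auto simp: dist_commute)
      then have "\<psi> n s \<in> ball 1 e"
        using seg[of n s] closed_segment_subset[OF _ _ convex_ball] by blast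
      then show ?case by (simp add: dist_commute)
    qed
  qed
  define x where "x n = left_regular G (a n)" for n
  define f where "f n y = (\<psi> (Suc n) (a n) - \<psi> n (a n)) * fourier G y (a n)" for n y
  \<comment> \<open>Telescoping: consecutive multipliers differ only at the point
    \<open>a m\<close>.\<close>
  have partial: "(\<Sum>n<m. f n y *\<^sub>C x n) = multiplier_op G (\<psi> m) y" for m y
  proof (induction m)
    case 0
    then show ?case by (simp add: \<psi>0 multiplier_op_def)
  next
    case (Suc m)
    define A where "A = insert (a m) ({s. \<psi> m s \<noteq> 0} \<union> {s. \<psi> (Suc m) s \<noteq> 0})"
    have A: "finite A" "A \<subseteq> carrier G" using fin a by (auto simp: A_def)
    have "multiplier_op G (\<psi> (Suc m)) y - multiplier_op G (\<psi> m) y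
        = (\<Sum>s\<in>A. (\<psi> (Suc m) s * fourier G y s) *\<^sub>C left_regular G s)
          - (\<Sum>s\<in>A. (\<psi> m s * fourier G y s) *\<^sub>C left_regular G s)"
      using A by (intro arg_cong2[of _ _ _ _ minus] multiplier_op_eq_sum) (auto simp: A_def)
    also have "\<dots> = (\<Sum>s\<in>A. ((\<psi> (Suc m) s - \<psi> m s) * fourier G y s) *\<^sub>C left_regular G s)"
      by (simp add: sum_subtractf[symmetric] complex_op.scale_left_diff_distrib left_diff_distrib)
    also have "\<dots> = (\<Sum>s\<in>{a m}. ((\<psi> (Suc m) s - \<psi> m s) * fourier G y s) *\<^sub>C left_regular G s)"
      using A by (intro sum.mono_neutral_right) (auto simp: A_def a_eq)
    also have "\<dots> = f m y *\<^sub>C x m" by (simp add: f_def x_def)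
    finally show ?case using Suc by (simp add: algebra_simps)
  qed
  have "cb_frame ?X x f"
    unfolding cb_frame_def
  proof (intro conjI allI ballI)
    show "x n \<in> ?X" for n by (simp add: x_def left_regular_in a)
    show "f n \<in> op_dual ?X" for n
    proof -
      have "cmod (f n y) \<le> cmod (\<psi> (Suc n) (a n) - \<psi> n (a n)) * norm y" for y
        by (simp add: f_def norm_mult cmod_fourier_le mult_left_mono)
      then have "\<exists>K. \<forall>y\<in>?X. cmod (f n y) \<le> K * norm y" by blast
      moreover have "f n (y + z) = f n y + f n z" "f n (c *\<^sub>C y) = c * f n y" for c y z
        by (simp_all add: f_def fourier_add fourier_scaleC distrib_left)
      ultimately show ?thesis unfolding op_dual_def by simp
    qed
    show "(\<lambda>n. f n y *\<^sub>C x n) sums y" if "y \<in> ?X" for y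
      unfolding sums_def partial
    proof (rule tendsto_identity_on_reduced_Cstar[OF multiplier_op_add multiplier_op_scaleC _ _ that])
      show "norm (multiplier_op G (\<psi> n) z) \<le> (C + 1) * norm z" if "z \<in> ?X" for n z
        by (rule cb_bound_norm_le[OF cb subspace_reduced_Cstar that multiplier_op_scaleC])
      show "(\<lambda>n. multiplier_op G (\<psi> n) (left_regular G s)) \<longlonglongrightarrow> left_regular G s"
        if s: "s \<in> carrier G" for s
      proof -
        have "bounded_linear (\<lambda>c. c *\<^sub>C left_regular G s)"
        proof (rule bounded_linear_intro[where K = "norm (left_regular G s)"])
          show "(r *\<^sub>R c) *\<^sub>C left_regular G s = r *\<^sub>R (c *\<^sub>C left_regular G s)" for r c
            by (simp add: scaleR_conv_of_real flip: scaleC_op_of_real)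
        qed (auto simp: complex_op.scale_left_distrib norm_scaleC_op_le)
        from bounded_linear.tendsto[OF this \<psi>_lim[OF s]]
        show ?thesis by (simp add: multiplier_op_left_regular fin' s)
      qed
    qed
    have "cb_norm ?X (\<lambda>y. \<Sum>n<m. f n y *\<^sub>C x n) \<le> ennreal (C + 1)" for m
      unfolding partial using cb C by (subst cb_norm_le_iff) auto
    then have "(SUP m. cb_norm ?X (\<lambda>y. \<Sum>n<m. f n y *\<^sub>C x n)) \<le> ennreal (C + 1)"
      by (rule SUP_least)
    then show "(SUP m. cb_norm ?X (\<lambda>y. \<Sum>n<m. f n y *\<^sub>C x n)) < \<infinity>"
      by (rule order_le_less_trans) simp
  qed
  then show ?thesis unfolding has_cb_frame_def by blast
qed

section \<open>From a frame to weak amenability\<close>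

lemma finite_fourier_support:
  assumes "T \<in> complex_op.span (left_regular G ` carrier G)"
  shows "finite {s. fourier G T s \<noteq> 0}"
proof -
  have "complex_op.span (left_regular G ` carrier G) \<subseteq> {T. finite {s. fourier G T s \<noteq> 0}}"
  proof (rule complex_op.span_minimal)
    show "left_regular G ` carrier G \<subseteq> {T. finite {s. fourier G T s \<noteq> 0}}"
      by (auto simp: fourier_left_regular)
    show "complex_op.subspace {T. finite {s. fourier G T s \<noteq> 0}}"
    proof (rule complex_op.subspaceI)
      show "0 \<in> {T. finite {s. fourier G T s \<noteq> 0}}" by (simp add: fourier_zero)
      show "x + y \<in> {T. finite {s. fourier G T s \<noteq> 0}}"
        if "x \<in> {T. finite {s. fourier G T s \<noteq> 0}}" "y \<in> {T. finite {s. fourier G T s \<noteq> 0}}" for x y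
      proof -
        have "{s. fourier G (x + y) s \<noteq> 0} \<subseteq> {s. fourier G x s \<noteq> 0} \<union> {s. fourier G y s \<noteq> 0}"
          by (auto simp: fourier_add)
        then show ?thesis using that finite_subset by auto
      qed
      show "c *\<^sub>C x \<in> {T. finite {s. fourier G T s \<noteq> 0}}"
        if "x \<in> {T. finite {s. fourier G T s \<noteq> 0}}" for c x
        using that by (auto simp: fourier_scaleC elim: rev_finite_subset)
    qed
  qed
  then show ?thesis using assms by blast
qed

lemma cb_bound_multiplier_op_average:
  assumes S: "cb_bound (reduced_Cstar G) S C" "0 \<le> C"
      "\<And>x. x \<in> reduced_Cstar G \<Longrightarrow> S x \<in> reduced_Cstar G"
      "\<And>c x. x \<in> reduced_Cstar G \<Longrightarrow> S (c *\<^sub>C x) = c *\<^sub>C S x"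
    and fin: "finite {s \<in> carrier G. \<phi> s \<noteq> 0}"
    and \<phi>: "\<And>s. s \<in> carrier G \<Longrightarrow> \<phi> s = fourier G (S (left_regular G s)) s"
  shows "cb_bound (reduced_Cstar G) (multiplier_op G \<phi>) C"
  unfolding cb_bound_def
proof (intro allI impI)
  fix n and T :: "nat \<Rightarrow> nat \<Rightarrow> 'a ell2_op"
  assume "\<forall>i<n. \<forall>j<n. T i j \<in> reduced_Cstar G" "op_matrix_bound {..<n} T 1"
  then show "op_matrix_bound {..<n} (\<lambda>i j. multiplier_op G \<phi> (T i j)) C"
    by (intro averaged_matrix_bound[OF S, of n T])
       (auto simp: multiplier_op_in fourier_multiplier_op[OF fin] \<phi>)
qed

lemma cb_frame_imp_weakly_amenable:
  assumes "has_cb_frame (reduced_Cstar G)"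
  shows "weakly_amenable G"
proof -
  let ?X = "reduced_Cstar G"
  note X = subspace_reduced_Cstar
  obtain x f where frame: "cb_frame ?X x f" using assms unfolding has_cb_frame_def by blast
  define S where "S m y = (\<Sum>n<m. f n y *\<^sub>C x n)" for m y
  have x: "x n \<in> ?X" and f: "f n \<in> op_dual ?X" for n
    using frame by (auto simp: cb_frame_def)
  have S_lim: "(\<lambda>m. S m y) \<longlonglongrightarrow> y" if "y \<in> ?X" for y
    using frame that by (auto simp: cb_frame_def sums_def S_def)
  have "(SUP m. cb_norm ?X (S m)) < \<infinity>"
    using frame by (simp add: cb_frame_def S_def[abs_def])
  then obtain C where C: "0 \<le> C" "\<And>m. cb_norm ?X (S m) \<le> ennreal C"
    using ennreal_bound_of_SUP[of "\<lambda>m. cb_norm ?X (S m)" UNIV] by auto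
  have S_cb: "cb_bound ?X (S m) C" for m using C cb_norm_le_iff by blast
  have "\<exists>K\<ge>0. \<forall>y\<in>?X. cmod (f n y) \<le> K * norm y" for n
  proof -
    obtain K where K: "\<And>y. y \<in> ?X \<Longrightarrow> cmod (f n y) \<le> K * norm y"
      using f[of n] unfolding op_dual_def by blast
    have "cmod (f n y) \<le> \<bar>K\<bar> * norm y" if "y \<in> ?X" for y
      using K[OF that] mult_right_mono[OF abs_ge_self norm_ge_zero, of K y] by linarith
    then show ?thesis by (intro exI[of _ "\<bar>K\<bar>"]) simp
  qed
  then obtain K where K: "\<And>n. 0 \<le> K n" "\<And>n y. y \<in> ?X \<Longrightarrow> cmod (f n y) \<le> K n * norm y"
    by metis
  let ?span = "complex_op.span (left_regular G ` carrier G)"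
  \<comment> \<open>The tolerance is shared by \<open>m\<close> terms, whose total is then at most
    \<open>inverse (real (Suc m))\<close>: at most 1 for the cb-norm, and tending to 0 for the
    pointwise limit. The approximants therefore depend on \<open>m\<close> as well as on
    \<open>n\<close>.\<close>
  have "\<exists>z\<in>?span. K n * norm (z - x n) \<le> inverse (real (Suc m)) / real (Suc m)" for m n
  proof -
    define d where "d = inverse (real (Suc m)) / real (Suc m)"
    \<comment> \<open>Adding 1 guards against \<open>K n = 0\<close>.\<close>
    have "d / (K n + 1) > 0" using K(1)[of n] by (simp add: d_def)
    then obtain z where z: "z \<in> ?span" "dist z (x n) < d / (K n + 1)"
      using x[of n] unfolding reduced_Cstar_def closure_approachable by blast
    have "K n * norm (z - x n) \<le> (K n + 1) * norm (z - x n)"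
      by (intro mult_right_mono) auto
    also have "\<dots> \<le> d"
      using z K(1)[of n] by (simp add: dist_norm field_simps)
    finally show ?thesis using z by (auto simp: d_def)
  qed
  then have "\<forall>m n. \<exists>z. z \<in> ?span \<and> K n * norm (z - x n) \<le> inverse (real (Suc m)) / real (Suc m)"
    by blast
  then obtain z where "\<forall>m n. z m n \<in> ?span \<and> K n * norm (z m n - x n) \<le> inverse (real (Suc m)) / real (Suc m)"
    by (simp only: choice_iff) blast
  then have z: "z m n \<in> ?span"
    and close: "K n * norm (z m n - x n) \<le> inverse (real (Suc m)) / real (Suc m)" for m n
    by (simp_all only:)
  have error: "(\<Sum>n<m. K n * norm (z m n - x n)) \<le> inverse (real (Suc m))" for m
  proof -
    have "(\<Sum>n<m. K n * norm (z m n - x n)) \<le> real m * (inverse (real (Suc m)) / real (Suc m))"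
      using sum_bounded_above[of "{..<m}" "\<lambda>n. K n * norm (z m n - x n)", OF close] by simp
    also have "\<dots> = inverse (real (Suc m)) * (real m / real (Suc m))" by simp
    also have "\<dots> \<le> inverse (real (Suc m)) * 1" by (intro mult_left_mono) auto
    finally show ?thesis by simp
  qed
  have zX: "z m n \<in> ?X" for m n
    using z closure_subset unfolding reduced_Cstar_def by blast
  define S' where "S' m y = (\<Sum>n<m. f n y *\<^sub>C z m n)" for m y
  have S'_eq: "S' m y = S m y + (\<Sum>n<m. f n y *\<^sub>C (z m n - x n))" for m y
    by (simp add: S'_def S_def complex_op.scale_right_diff_distrib sum_subtractf)
  have S'_cb: "cb_bound ?X (S' m) (C + 1)" for m
  proof -
    have "cb_bound ?X (\<lambda>y. S m y + (\<Sum>n<m. f n y *\<^sub>C (z m n - x n))) (C + (\<Sum>n<m. K n * norm (z m n - x n)))"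
      by (intro cb_bound_add S_cb cb_bound_sum cb_bound_rank_one X f K reduced_Cstar_clinear) auto
    moreover have "C + (\<Sum>n<m. K n * norm (z m n - x n)) \<le> C + 1"
      using order_trans[OF error[of m], of 1] by (simp add: inverse_le_1_iff)
    ultimately show ?thesis
      unfolding S'_eq[abs_def] by (rule cb_bound_mono)
  qed
  have S'_X: "S' m y \<in> ?X" for m y
    unfolding S'_def by (intro complex_op.subspace_sum[OF X] complex_op.subspace_scale[OF X] zX)
  have S'_scale: "S' m (c *\<^sub>C y) = c *\<^sub>C S' m y" if "y \<in> ?X" for m c y
    using f that by (simp add: S'_def op_dual_def complex_op.scale_sum_right)
  define \<phi> where "\<phi> m s = fourier G (S' m (left_regular G s)) s" for m s
  \<comment> \<open>The scalars \<open>f n (left_regular G s)\<close> may be nonzero for infinitely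
    many \<open>s\<close>; the support is confined by the coefficients of the finitely many
    \<open>z m n\<close> with \<open>n < m\<close>.\<close>
  have fin: "finite {s \<in> carrier G. \<phi> m s \<noteq> 0}" for m
  proof (rule finite_subset)
    show "{s \<in> carrier G. \<phi> m s \<noteq> 0} \<subseteq> (\<Union>n<m. {s. fourier G (z m n) s \<noteq> 0})"
    proof
      fix s assume "s \<in> {s \<in> carrier G. \<phi> m s \<noteq> 0}"
      then have "(\<Sum>n<m. f n (left_regular G s) * fourier G (z m n) s) \<noteq> 0"
        by (simp add: \<phi>_def S'_def fourier_sum fourier_scaleC)
      then obtain n where "n < m" "f n (left_regular G s) * fourier G (z m n) s \<noteq> 0"
        by (meson lessThan_iff sum.not_neutral_contains_not_neutral)
      then show "s \<in> (\<Union>n<m. {s. fourier G (z m n) s \<noteq> 0})" by auto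
    qed
    show "finite (\<Union>n<m. {s. fourier G (z m n) s \<noteq> 0})"
      using finite_fourier_support[OF z] by blast
  qed
  have \<phi>_lim: "(\<lambda>m. \<phi> m s) \<longlonglongrightarrow> 1" if s: "s \<in> carrier G" for s
  proof -
    let ?l = "left_regular G s"
    have l: "?l \<in> ?X" "norm ?l \<le> 1" using s by (auto simp: left_regular_in norm_left_regular_le)
    have "norm (\<phi> m s - 1) \<le> norm (S m ?l - ?l) + inverse (real (Suc m))" for m
    proof -
      have "norm (f n ?l *\<^sub>C (z m n - x n)) \<le> K n * norm (z m n - x n)" for n
      proof -
        have "cmod (f n ?l) \<le> K n"
          using K(2)[OF l(1), of n] mult_left_mono[OF l(2) K(1)[of n]] by simp
        then show ?thesis
          by (intro order_trans[OF norm_scaleC_op_le] mult_right_mono) auto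
      qed
      then have "norm (\<Sum>n<m. f n ?l *\<^sub>C (z m n - x n)) \<le> inverse (real (Suc m))"
        by (intro order_trans[OF norm_sum] order_trans[OF sum_mono error])
      \<comment> \<open>The coefficient of \<open>left_regular G s\<close> at \<open>s\<close> is 1,
        so the error is itself a Fourier coefficient and is bounded by an operator norm.\<close>
      moreover have "\<phi> m s - 1 = fourier G (S' m ?l - ?l) s"
        using s by (simp add: \<phi>_def fourier_diff fourier_left_regular)
      then have "norm (\<phi> m s - 1) \<le> norm (S' m ?l - ?l)"
        by (simp add: cmod_fourier_le)
      moreover have "S' m ?l - ?l = (S m ?l - ?l) + (\<Sum>n<m. f n ?l *\<^sub>C (z m n - x n))"
        by (simp add: S'_eq)
      ultimately show ?thesis
        using norm_triangle_ineq[of "S m ?l - ?l" "\<Sum>n<m. f n ?l *\<^sub>C (z m n - x n)"] by simp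
    qed
    moreover have "(\<lambda>m. norm (S m ?l - ?l) + inverse (real (Suc m))) \<longlonglongrightarrow> 0"
      using tendsto_add[OF tendsto_norm[OF LIM_zero[OF S_lim[OF l(1)]]] LIMSEQ_inverse_real_of_nat] by simp
    ultimately have "(\<lambda>m. \<phi> m s - 1) \<longlonglongrightarrow> 0"
      by (rule Lim_null_comparison[OF always_eventually[OF allI]])
    then show ?thesis by (rule LIM_zero_cancel)
  qed
  have cb: "cb_norm ?X (multiplier_op G (\<phi> m)) \<le> ennreal (C + 1)" for m
    using C S'_X S'_scale fin
    by (subst cb_norm_le_iff) (auto intro!: cb_bound_multiplier_op_average[OF S'_cb[of m]] simp: \<phi>_def)
  show ?thesis
    unfolding weakly_amenable_def
  proof (intro exI conjI ballI)
    \<comment> \<open>The sequence enters the filter formulation as the image of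
      \<open>sequentially\<close>, with its range as the set of members.\<close>
    show "filtermap \<phi> sequentially \<noteq> bot" by (simp add: filtermap_bot_iff)
    show "filtermap \<phi> sequentially \<le> principal (range \<phi>)"
      by (simp add: le_principal eventually_filtermap)
    show "finite {s \<in> carrier G. \<psi> s \<noteq> 0}" if "\<psi> \<in> range \<phi>" for \<psi>
      using that fin by auto
    show "((\<lambda>\<psi>. \<psi> s) \<longlongrightarrow> 1) (filtermap \<phi> sequentially)" if "s \<in> carrier G" for s
      using \<phi>_lim[OF that] by (simp add: filterlim_filtermap)
    show "is_multiplier G \<psi> (multiplier_op G \<psi>)" if "\<psi> \<in> range \<phi>" for \<psi>
      using that fin is_multiplier_multiplier_op by auto
    have "(SUP \<psi>\<in>range \<phi>. cb_norm ?X (multiplier_op G \<psi>)) \<le> ennreal (C + 1)"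
      using cb by (intro SUP_least) auto
    then show "(SUP \<psi>\<in>range \<phi>. cb_norm ?X (multiplier_op G \<psi>)) < \<infinity>"
      by (rule order_le_less_trans) simp
  qed
qed

end

theorem mainTheorem5:
  fixes G :: "('a, 'b) monoid_scheme"
  assumes "group G" and "countable (carrier G)"
  shows "weakly_amenable G \<longleftrightarrow> has_cb_frame (reduced_Cstar G)"
  using group.weakly_amenable_imp_cb_frame[OF assms] group.cb_frame_imp_weakly_amenable[OF assms(1)]
  by blast

end
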